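(* Let $G_n$ denote the number of pairwise non-isomorphic fringe subtrees of a random binary search tree with $n$ leaves. There are two constants $c_3 \approx 1.5470025923$ and $c_4 \approx 1.8191392203$ such that, as $n\to\infty$: (i) $\displaystyle c_3 \frac{n}{\ln n}(1+o(1)) \le \mathbb{E}(G_n) \le c_4 \frac{n}{\ln n}(1+o(1))$; (ii) with high probability, $\displaystyle c_3 \frac{n}{\ln n}(1+o(1)) \le G_n \le c_4 \frac{n}{\ln n}(1+o(1))$, i.e. for every fixed $\eta>0$, $\mathbb{P}\big((c_3-\eta)\frac{n}{\ln n} \le G_n \le (c_4+\eta)\frac{n}{\ln n}\big)\to 1$.
   Context: A binary tree is a rooted tree in which every node has either exactly two children or none; it is ordered if the children of each inner node are ordered. The size $|t|$ of a binary tree $t$ is its number of leaves. For a node $v$ of $t$, $t(v)$ denotes the fringe subtree rooted at $v$ (the node $v$ together with all its descendants). A random binary search tree with $n$ leaves is a random ordered binary tree $T$ with $n$ leaves distributed according to $P_{\mathrm{bst}}(t)=\prod_{v\in t,\ |t(v)|>1} \frac{1}{|t(v)|-1}$ (equivalently, the tree obtained by inserting a uniformly random permutation of $n-1$ keys into a binary search tree, leaves being the external nodes). Two ordered binary trees are isomorphic if they are equal as unordered rooted trees. "With high probability" means with probability tending to $1$ as $n\to\infty$. *)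

theory Defs
  imports "HOL-Probability.Probability" "HOL-Library.Tree" "HOL-Library.Multiset"
    "HOL-Library.Landau_Symbols"
begin

text \<open>
  Ordered binary trees are unlabelled trees from \<^theory>\<open>HOL-Library.Tree\<close>: every \<^const>\<open>Node\<close> has
  exactly two children and the nodes without children are the \<^const>\<open>Leaf\<close>s. The size of a tree is
  its number of leaves, which is \<^const>\<open>size1\<close> (and not \<^const>\<open>size\<close>, the number of inner nodes).
\<close>

type_synonym btree = "unit tree"

text \<open>The multiset of the fringe subtrees \<open>t(v)\<close>, one for each node \<open>v\<close> of \<open>t\<close>.\<close>

fun fringe :: "'a tree \<Rightarrow> 'a tree multiset" where
  "fringe Leaf = {#Leaf#}"
| "fringe (Node l a r) = {#Node l a r#} + fringe l + fringe r"

lemma set_mset_fringe: "set_mset (fringe t) = subtrees t"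
  by (induction t) auto

text \<open>An unordered rooted tree is a root together with the multiset of its branches.\<close>

datatype utree = UNode "utree multiset"

fun unordered :: "'a tree \<Rightarrow> utree" where
  "unordered Leaf = UNode {#}"
| "unordered (Node l a r) = UNode {#unordered l, unordered r#}"

definition isomorphic :: "btree \<Rightarrow> btree \<Rightarrow> bool" where
  "isomorphic s t \<longleftrightarrow> unordered s = unordered t"

definition num_noniso_fringe :: "btree \<Rightarrow> nat" where
  "num_noniso_fringe t = card (set_mset (fringe t) // {(s, s'). isomorphic s s'})"

lemma equiv_isomorphic: "equiv UNIV {(s, s'). isomorphic s s'}"
  by (auto simp: isomorphic_def intro!: equivI refl_onI symI transI)

lemma isomorphic_Node_iff:
  "isomorphic (Node l a r) (Node l' a' r') \<longleftrightarrow>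
     isomorphic l l' \<and> isomorphic r r' \<or> isomorphic l r' \<and> isomorphic r l'"
  by (auto simp: isomorphic_def add_eq_conv_ex)

lemma num_noniso_fringe_altdef: "num_noniso_fringe t = card (unordered ` subtrees t)"
proof -
  let ?R = "{(s :: btree, s'). isomorphic s s'}"
  let ?C = "\<lambda>u. {s' :: btree. u = unordered s'}"
  have "set_mset (fringe t) // ?R = ?C ` unordered ` subtrees t"
    by (auto simp: quotient_def set_mset_fringe isomorphic_def image_iff)
  moreover have "inj_on ?C (unordered ` subtrees t)"
    by (rule inj_onI) blast
  ultimately show ?thesis
    by (simp add: num_noniso_fringe_def card_image)
qed

definition P_bst :: "btree \<Rightarrow> real" where
  "P_bst t = (\<Prod>s \<in># filter_mset (\<lambda>s. size1 s > 1) (fringe t). 1 / (real (size1 s) - 1))"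

text \<open>
  The random binary search tree with \<open>n\<close> leaves. This is only meaningful for \<open>n \<ge> 1\<close>, as there is
  no tree without leaves.
\<close>

definition bst_pmf :: "nat \<Rightarrow> btree pmf" where
  "bst_pmf n = embed_pmf (\<lambda>t. if size1 t = n then P_bst t else 0)"

lemma P_bst_Leaf: "P_bst Leaf = 1"
  by (simp add: P_bst_def)

lemma P_bst_Node:
  "P_bst (Node l a r) = P_bst l * P_bst r / (real (size1 l + size1 r) - 1)"
proof -
  have "size1 l + size1 r > 1"
    using size1_ge0[of l] size1_ge0[of r] by linarith
  thus ?thesis
    by (simp add: P_bst_def)
qed

lemma P_bst_nonneg: "P_bst t \<ge> 0"
proof (induction t)
  case (Node l a r)
  have "real (size1 l + size1 r) \<ge> 1"
    using size1_ge0[of l] size1_ge0[of r] by linarith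
  with Node show ?case
    by (simp add: P_bst_Node)
qed (simp add: P_bst_Leaf)

lemma trees_size1_rec:
  assumes "n \<ge> 2"
  shows "{t :: btree. size1 t = n} =
    (\<lambda>(k, l, r). Node l () r) `
      (SIGMA k:{1..<n}. {l. size1 l = k} \<times> {r. size1 r = n - k})" (is "?A = ?f ` ?B")
proof
  show "?A \<subseteq> ?f ` ?B"
  proof
    fix t assume "t \<in> ?A"
    hence t: "size1 t = n" by simp
    with assms obtain l r where lr: "t = Node l () r"
      by (cases t) auto
    have "(size1 l, l, r) \<in> ?B"
      using t lr size1_ge0[of l] size1_ge0[of r] by (auto simp: Suc_le_eq simp del: size1_ge0)
    thus "t \<in> ?f ` ?B"
      using lr by (auto intro!: image_eqI[where x = "(size1 l, l, r)"])
  qed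
qed auto

lemma trees_size1_1: "{t :: 'a tree. size1 t = Suc 0} = {Leaf}"
proof -
  have "t = Leaf" if "size1 t = Suc 0" for t :: "'a tree"
    using that by (cases t) (auto simp: size1_size)
  thus ?thesis by auto
qed

lemma finite_trees_size1: "finite {t :: btree. size1 t = n}"
proof (induction n rule: less_induct)
  case (less n)
  consider "n = 0" | "n = 1" | "n \<ge> 2" by linarith
  thus ?case
  proof cases
    case 1
    have "{t :: btree. size1 t = n} = {}"
      using 1 by (auto simp: size1_size)
    thus ?thesis by simp
  next
    case 2
    thus ?thesis by (simp add: trees_size1_1)
  next
    case 3
    show ?thesis
      unfolding trees_size1_rec[OF 3] using less.IH by (intro finite_imageI finite_SigmaI) auto
  qed
qed

lemma sum_P_bst:
  assumes "n \<ge> 1"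
  shows "(\<Sum>t | size1 t = n. P_bst t) = 1"
  using assms
proof (induction n rule: less_induct)
  case (less n)
  show ?case
  proof (cases "n = 1")
    case True
    thus ?thesis by (simp add: trees_size1_1 P_bst_Leaf)
  next
    case False
    with less.prems have n: "n \<ge> 2" by simp
    define B :: "(nat \<times> btree \<times> btree) set"
      where "B = (SIGMA k:{1..<n}. {l. size1 l = k} \<times> {r. size1 r = n - k})"
    have inj: "inj_on (\<lambda>(k, l, r). Node l () r) B"
      by (auto simp: B_def inj_on_def)
    have "(\<Sum>t | size1 t = n. P_bst t) = (\<Sum>(k, l, r)\<in>B. P_bst (Node l () r))"
      unfolding trees_size1_rec[OF n] B_def[symmetric]
      by (subst sum.reindex[OF inj]) (simp add: case_prod_unfold)
    also have "\<dots> = (\<Sum>(k, l, r)\<in>B. P_bst l * P_bst r / (real n - 1))"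
      by (intro sum.cong) (auto simp: P_bst_Node B_def of_nat_diff)
    also have "\<dots> = (\<Sum>k\<in>{1..<n}. \<Sum>(l, r)\<in>{l. size1 l = k} \<times> {r. size1 r = n - k}.
                      P_bst l * P_bst r / (real n - 1))"
      unfolding B_def by (subst sum.Sigma) (auto intro!: finite_trees_size1)
    also have "\<dots> = (\<Sum>k\<in>{1..<n}. (\<Sum>l | size1 l = k. P_bst l) *
                      (\<Sum>r | size1 r = n - k. P_bst r) / (real n - 1))"
      by (simp add: sum_product sum.cartesian_product sum_divide_distrib case_prod_unfold)
    also have "\<dots> = (\<Sum>k\<in>{1..<n}. 1 / (real n - 1))"
      by (intro sum.cong) (auto simp: less.IH)
    also have "\<dots> = 1"
      using n by (simp add: of_nat_diff)
    finally show ?thesis .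
  qed
qed

lemma pmf_bst_pmf:
  assumes "n \<ge> 1"
  shows "pmf (bst_pmf n) t = (if size1 t = n then P_bst t else 0)"
  unfolding bst_pmf_def
proof (rule pmf_embed_pmf)
  let ?f = "\<lambda>t. if size1 t = n then P_bst t else 0"
  show "\<And>t. 0 \<le> ?f t"
    by (simp add: P_bst_nonneg)
  have "(\<integral>\<^sup>+ t. ennreal (?f t) \<partial>count_space UNIV) = (\<Sum>t | size1 t = n. ennreal (?f t))"
    by (rule nn_integral_count_space') (auto simp: finite_trees_size1)
  also have "\<dots> = ennreal (\<Sum>t | size1 t = n. P_bst t)"
    by (simp add: P_bst_nonneg)
  also have "\<dots> = 1"
    using sum_P_bst[OF assms] by simp
  finally show "(\<integral>\<^sup>+ t. ennreal (?f t) \<partial>count_space UNIV) = 1" .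
qed

end

theory Submission
  imports Defs "HOL-Analysis.Harmonic_Numbers" "HOL-Real_Asymp.Real_Asymp"
begin

text \<open>
  A random tree with \<open>n\<close> leaves has \<open>2n/(k+1) - 1\<close> fringe subtrees of size greater than \<open>k\<close> on average,
  with a variance of order at most \<open>k\<^sup>2 n\<close>.

  Upper bound: if \<open>k\<close> is slightly below \<open>ln n / ln b\<close>, where \<open>b\<close> is the growth rate of the number of
  unordered binary trees, there are only \<open>o(n / ln n)\<close> classes of size at most \<open>k\<close>, and every larger
  subtree is counted as if it were new. Hence \<open>c\<^sub>4 = 2 ln b\<close>.

  Lower bound: a random tree of size \<open>m\<close> belongs with high probability to a class of probability at
  most \<open>e\<^bsup>-\<theta>m\<^esup>\<close>, for every \<open>\<theta>\<close> below the entropy rate of the class of a random tree (an additive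
  functional concentrates around its mean). If \<open>k\<close> is slightly above \<open>ln n / \<theta>\<close>, there are \<open>o(n / ln n)\<close>
  pairs of isomorphic subtrees in such classes of size greater than \<open>k\<close>, so that nearly all these
  subtrees are distinct. Hence \<open>c\<^sub>3\<close> is twice the entropy rate.

  As only bounds are claimed, \<open>c\<^sub>3\<close> may be chosen slightly below and \<open>c\<^sub>4\<close> slightly above these values;
  this leaves room for vanishing error terms, and only one-sided numerical estimates are needed.
\<close>

section \<open>Averages over random binary search trees\<close>

text \<open>The class of a tree has as probability the product of \<open>2 / (m - 1)\<close> over
  the inner nodes, \<open>m\<close> being the size at the node, with \<open>1\<close> instead of
  \<open>2\<close> where the two branches are isomorphic. Hence the entropy rate is \<open>2 *
  (\<Sum>k\<ge>2. (ln (k - 1) + ln 2 * s k) / (k * (k + 1))) - ln 2\<close>, where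
  \<open>s k\<close> is the probability that the root of a random tree of size \<open>k\<close> has
  isomorphic branches. The rounded constants of the statement leave a window of
  \<open>10 ^ -10\<close>, and two things make this precision hard to reach. First,
  \<open>s (2 * j)\<close> is the probability that two random trees of size \<open>j\<close> are
  isomorphic, divided by \<open>2 * j - 1\<close>; the recursion for it involves higher moments of
  the class probability. Second, the logarithmic series converges slowly, so it is summed by parts
  and its tail is bounded by a telescoping expansion. On the probabilistic side, all first and
  second moments are obtained by splitting at the root: the two branches are independent once their
  sizes are given.\<close>

definition bst_avg :: "nat \<Rightarrow> (btree \<Rightarrow> real) \<Rightarrow> real" where
  "bst_avg n f = (\<Sum>t | size1 t = n. P_bst t * f t)"

lemma expectation_bst_pmf:
  fixes f :: "btree \<Rightarrow> real"
  assumes "n \<ge> 1"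
  shows "measure_pmf.expectation (bst_pmf n) f = bst_avg n f"
proof -
  have "measure_pmf.expectation (bst_pmf n) f = (\<Sum>t | size1 t = n. f t * pmf (bst_pmf n) t)"
    by (rule integral_measure_pmf_real)
       (auto simp: finite_trees_size1 set_pmf_iff pmf_bst_pmf[OF assms] split: if_splits)
  also have "\<dots> = bst_avg n f"
    unfolding bst_avg_def by (intro sum.cong) (auto simp: pmf_bst_pmf[OF assms])
  finally show ?thesis .
qed

lemma prob_bst_pmf:
  assumes "n \<ge> 1"
  shows "measure_pmf.prob (bst_pmf n) {t. Q t} = bst_avg n (\<lambda>t. of_bool (Q t))"
proof -
  have "measure_pmf.prob (bst_pmf n) {t. Q t} = measure_pmf.expectation (bst_pmf n) (indicator {t. Q t})"
    by simp
  also have "(indicator {t. Q t} :: btree \<Rightarrow> real) = (\<lambda>t. of_bool (Q t))"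
    by (auto simp: fun_eq_iff)
  finally show ?thesis
    by (simp add: expectation_bst_pmf[OF assms])
qed

lemma bst_avg_const: "n > 0 \<Longrightarrow> bst_avg n (\<lambda>_. c) = c"
  by (simp add: bst_avg_def sum_P_bst flip: sum_distrib_right)

lemma bst_avg_add: "bst_avg n (\<lambda>t. f t + g t) = bst_avg n f + bst_avg n g"
  by (simp add: bst_avg_def distrib_left sum.distrib)

lemma bst_avg_diff: "bst_avg n (\<lambda>t. f t - g t) = bst_avg n f - bst_avg n g"
  by (simp add: bst_avg_def right_diff_distrib sum_subtractf)

lemma bst_avg_cmult: "bst_avg n (\<lambda>t. c * f t) = c * bst_avg n f"
  unfolding bst_avg_def sum_distrib_left by (intro sum.cong) auto

lemma bst_avg_cmult_right: "bst_avg n (\<lambda>t. f t * c) = bst_avg n f * c"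
  unfolding bst_avg_def sum_distrib_right by (intro sum.cong) auto

lemma bst_avg_divide: "bst_avg n (\<lambda>t. f t / c) = bst_avg n f / c"
  by (simp add: bst_avg_def sum_divide_distrib)

lemma bst_avg_sum: "bst_avg n (\<lambda>t. \<Sum>i\<in>I. f i t) = (\<Sum>i\<in>I. bst_avg n (f i))"
  unfolding bst_avg_def sum_distrib_left by (rule sum.swap)

lemma bst_avg_mono:
  "(\<And>t. size1 t = n \<Longrightarrow> f t \<le> g t) \<Longrightarrow> bst_avg n f \<le> bst_avg n g"
  unfolding bst_avg_def by (intro sum_mono mult_left_mono) (auto simp: P_bst_nonneg)

lemma bst_avg_cong:
  "(\<And>t. size1 t = n \<Longrightarrow> f t = g t) \<Longrightarrow> bst_avg n f = bst_avg n g"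
  unfolding bst_avg_def by (intro sum.cong) auto

lemma bst_avg_nonneg: "(\<And>t. size1 t = n \<Longrightarrow> 0 \<le> f t) \<Longrightarrow> 0 \<le> bst_avg n f"
  unfolding bst_avg_def by (intro sum_nonneg mult_nonneg_nonneg) (auto simp: P_bst_nonneg)

lemma bst_avg_le_const: "n > 0 \<Longrightarrow> (\<And>t. size1 t = n \<Longrightarrow> f t \<le> c) \<Longrightarrow> bst_avg n f \<le> c"
  using bst_avg_mono[of n f "\<lambda>_. c"] by (simp add: bst_avg_const)

lemma bst_avg_1: "bst_avg (Suc 0) f = f Leaf"
  by (simp add: bst_avg_def trees_size1_1 P_bst_Leaf)

text \<open>The size of the left branch is uniform on \<open>{1..<n}\<close>, and given it the
  branches are independent random trees. All moment recursions start from this.\<close>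

lemma bst_avg_rec:
  assumes "n \<ge> 2"
  shows "bst_avg n f =
    (\<Sum>k\<in>{1..<n}. bst_avg k (\<lambda>l. bst_avg (n - k) (\<lambda>r. f (Node l () r)))) / (real n - 1)"
proof -
  define B :: "(nat \<times> btree \<times> btree) set"
    where "B = (SIGMA k:{1..<n}. {l. size1 l = k} \<times> {r. size1 r = n - k})"
  have inj: "inj_on (\<lambda>(k, l, r). Node l () r) B"
    by (auto simp: B_def inj_on_def)
  have "bst_avg n f = (\<Sum>(k, l, r)\<in>B. P_bst (Node l () r) * f (Node l () r))"
    unfolding bst_avg_def trees_size1_rec[OF assms] B_def[symmetric]
    by (subst sum.reindex[OF inj]) (simp add: case_prod_unfold)
  also have "\<dots> = (\<Sum>(k, l, r)\<in>B. P_bst l * (P_bst r * f (Node l () r)) / (real n - 1))"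
    by (intro sum.cong) (auto simp: P_bst_Node B_def of_nat_diff)
  also have "\<dots> = (\<Sum>k\<in>{1..<n}. \<Sum>(l, r)\<in>{l. size1 l = k} \<times> {r. size1 r = n - k}.
                    P_bst l * (P_bst r * f (Node l () r)) / (real n - 1))"
    unfolding B_def by (subst sum.Sigma) (auto intro!: finite_trees_size1)
  also have "\<dots> = (\<Sum>k\<in>{1..<n}. bst_avg k (\<lambda>l. bst_avg (n - k) (\<lambda>r. f (Node l () r)))) / (real n - 1)"
    by (simp add: sum_divide_distrib bst_avg_def sum_distrib_left flip: sum.cartesian_product)
  finally show ?thesis .
qed

lemma sum_split_swap:
  fixes f :: "nat \<Rightarrow> 'a :: comm_monoid_add"
  shows "(\<Sum>k\<in>{1..<n}. f (n - k)) = (\<Sum>k\<in>{1..<n}. f k)"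
  by (rule sum.reindex_bij_witness[where i = "\<lambda>k. n - k" and j = "\<lambda>k. n - k"]) auto

definition fringe_sum :: "(btree \<Rightarrow> real) \<Rightarrow> btree \<Rightarrow> real" where
  "fringe_sum g t = (\<Sum>s\<in>#fringe t. g s)"

lemma fringe_sum_simps [simp]:
  "fringe_sum g Leaf = g Leaf"
  "fringe_sum g (Node l u r) = g (Node l u r) + (fringe_sum g l + fringe_sum g r)"
  by (simp_all add: fringe_sum_def)

lemma fringe_sum_add: "fringe_sum (\<lambda>s. f s + g s) t = fringe_sum f t + fringe_sum g t"
  by (simp add: fringe_sum_def sum_mset.distrib)

lemma fringe_sum_sum: "fringe_sum (\<lambda>s. \<Sum>i\<in>I. f i s) t = (\<Sum>i\<in>I. fringe_sum (f i) t)"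
  by (induction t) (auto simp: sum.distrib)

lemma fringe_sum_mono: "(\<And>s. s \<in> subtrees t \<Longrightarrow> f s \<le> g s) \<Longrightarrow> fringe_sum f t \<le> fringe_sum g t"
  unfolding fringe_sum_def by (intro sum_mset_mono) (auto simp: set_mset_fringe)

lemma fringe_sum_cong: "(\<And>s. s \<in> subtrees t \<Longrightarrow> f s = g s) \<Longrightarrow> fringe_sum f t = fringe_sum g t"
  unfolding fringe_sum_def
  by (intro arg_cong[where f = sum_mset] image_mset_cong) (auto simp: set_mset_fringe)

lemma fringe_sum_nonneg: "(\<And>s. 0 \<le> g s) \<Longrightarrow> 0 \<le> fringe_sum g t"
  by (induction t) auto

lemma fringe_sum_const: "fringe_sum (\<lambda>_. c) t = c * (2 * real (size1 t) - 1)"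
  by (induction t) (auto simp: algebra_simps)

lemma size1_subtrees_le: "s \<in> subtrees t \<Longrightarrow> size1 s \<le> size1 t"
  by (induction t) auto

text \<open>Inserting the closed form of \<open>bst_avg_fringe_sum\<close> into the recursion at the
  root produces this double sum; multiplied by \<open>2 / (n - 1)\<close> it gives back the closed
  form.\<close>

lemma sum_harmonic_telescope:
  fixes \<gamma> :: "nat \<Rightarrow> real"
  shows "(\<Sum>j\<in>{1..<n}. \<gamma> j + 2 * real j * (\<Sum>k\<in>{1..<j}. \<gamma> k / (real k * (real k + 1)))) =
         real n * (real n - 1) * (\<Sum>k\<in>{1..<n}. \<gamma> k / (real k * (real k + 1)))"
proof (induction n)
  case (Suc n)
  define c where "c = (\<lambda>k. \<gamma> k / (real k * (real k + 1)))"
  have "\<gamma> n = c n * (real n * (real n + 1))" if "n > 0"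
    using that by (simp add: c_def)
  thus ?case
    using Suc unfolding c_def[symmetric]
    by (cases "n = 0") (simp_all add: sum.atLeastLessThan_Suc algebra_simps)
qed auto

text \<open>The fringe subtrees of size \<open>k < n\<close> of a random tree with \<open>n\<close> leaves number
  \<open>2n/(k(k+1))\<close> on average, and each of them is again a random binary search tree.\<close>

lemma bst_avg_fringe_sum:
  assumes "n \<ge> 1"
  shows "bst_avg n (fringe_sum g) =
    bst_avg n g + 2 * real n * (\<Sum>k\<in>{1..<n}. bst_avg k g / (real k * (real k + 1)))"
  using assms
proof (induction n rule: less_induct)
  case (less n)
  show ?case
  proof (cases "n = 1")
    case True
    thus ?thesis by (simp add: bst_avg_1)
  next
    case False
    with less.prems have n: "n \<ge> 2" by simp
    define M where "M = (\<lambda>k. bst_avg k (fringe_sum g))"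
    have "bst_avg n (fringe_sum g) = bst_avg n (\<lambda>t. g t + (fringe_sum g t - g t))"
      by simp
    also have "\<dots> = bst_avg n g + bst_avg n (\<lambda>t. fringe_sum g t - g t)"
      by (rule bst_avg_add)
    also have "bst_avg n (\<lambda>t. fringe_sum g t - g t) = (\<Sum>k\<in>{1..<n}. M k + M (n - k)) / (real n - 1)"
      unfolding bst_avg_rec[OF n] M_def
      by (intro arg_cong2[where f = "(/)"] sum.cong refl) (simp add: bst_avg_add bst_avg_const)
    also have "(\<Sum>k\<in>{1..<n}. M k + M (n - k)) = 2 * (\<Sum>k\<in>{1..<n}. M k)"
      by (simp only: sum.distrib sum_split_swap)
    also have "(\<Sum>k\<in>{1..<n}. M k) = (\<Sum>j\<in>{1..<n}. bst_avg j g
                  + 2 * real j * (\<Sum>k\<in>{1..<j}. bst_avg k g / (real k * (real k + 1))))"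
      by (intro sum.cong) (auto simp: M_def less.IH)
    also have "\<dots> = real n * (real n - 1) * (\<Sum>k\<in>{1..<n}. bst_avg k g / (real k * (real k + 1)))"
      by (rule sum_harmonic_telescope)
    finally show ?thesis
      using n by (simp add: mult_ac)
  qed
qed

lemma sum_inverse_product_telescope:
  assumes "1 \<le> m" "m \<le> n"
  shows "(\<Sum>k\<in>{m..<n}. 1 / (real k * (real k + 1))) = 1 / real m - 1 / real n"
  using assms(2)
proof (induction n rule: dec_induct)
  case (step n)
  have "real n > 0" using step assms by auto
  hence "1 / (real n * (real n + 1)) = 1 / real n - 1 / (real n + 1)"
    by (simp add: divide_simps)
  thus ?case using step by (simp add: sum.atLeastLessThan_Suc)
qed auto

section \<open>Concentration and isomorphism classes\<close>

lemma bst_avg_centered_square: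
  assumes "n > 0" "bst_avg n W = 0"
  shows "bst_avg n (\<lambda>t. (W t + a)\<^sup>2) = bst_avg n (\<lambda>t. (W t)\<^sup>2) + a\<^sup>2"
proof -
  have "bst_avg n (\<lambda>t. (W t + a)\<^sup>2) = bst_avg n (\<lambda>t. (W t)\<^sup>2 + (2 * a * W t + a\<^sup>2))"
    by (intro bst_avg_cong) (simp add: power2_eq_square algebra_simps)
  also have "\<dots> = bst_avg n (\<lambda>t. (W t)\<^sup>2) + a\<^sup>2"
    using assms by (simp add: bst_avg_add bst_avg_cmult bst_avg_const)
  finally show ?thesis .
qed

lemma fringe_sum_bounds:
  assumes "\<And>t. 0 \<le> g t" "\<And>t. g t \<le> B"
  shows "fringe_sum g t \<in> {0..2 * B * real (size1 t)}"
proof -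
  have "0 \<le> B" using assms[of Leaf] by linarith
  have "fringe_sum g t \<le> fringe_sum (\<lambda>_. B) t"
    using assms by (intro fringe_sum_mono)
  also have "\<dots> \<le> 2 * B * real (size1 t)"
    unfolding fringe_sum_const using \<open>0 \<le> B\<close> by (simp add: algebra_simps)
  finally show ?thesis
    using assms by (simp add: fringe_sum_nonneg)
qed

definition fringe_density :: "nat \<Rightarrow> (btree \<Rightarrow> real) \<Rightarrow> real" where
  "fringe_density K g = 2 * (\<Sum>k\<in>{1..K}. bst_avg k g / (real k * (real k + 1)))"

text \<open>The sum in \<open>bst_avg_fringe_sum\<close> stops at \<open>K\<close>, so the mean is
  exactly, not just asymptotically, linear in \<open>n\<close>. This exactness keeps the drift in
  \<open>bst_variance\<close> bounded.\<close>

lemma bst_avg_fringe_sum_truncated: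
  assumes zero: "\<And>t. size1 t > K \<Longrightarrow> g t = 0" and "n > K"
  shows "bst_avg n (fringe_sum g) = fringe_density K g * real n"
proof -
  have zero_avg: "bst_avg k g = 0" if "k > K" for k
    using zero that bst_avg_cong[of k g "\<lambda>_. 0"] by (simp add: bst_avg_def)
  have "(\<Sum>k\<in>{1..<n}. bst_avg k g / (real k * (real k + 1))) =
        (\<Sum>k\<in>{1..K}. bst_avg k g / (real k * (real k + 1)))"
    using zero_avg \<open>n > K\<close> by (intro sum.mono_neutral_right) auto
  thus ?thesis
    using assms zero_avg[of n] by (subst bst_avg_fringe_sum) (auto simp: fringe_density_def)
qed

text \<open>Splitting at the root gives \<open>V k + V (n - k) + d\<^sup>2\<close>, since the
  centred parts of the branches are independent; \<open>d\<close> is the change of the mean caused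
  by the split. Means are linear above \<open>K\<close> and within \<open>D / 2\<close> of the same
  line below, so \<open>\<bar>d\<bar> \<le> D\<close>.\<close>

lemma bst_variance:
  assumes g: "\<And>t. 0 \<le> g t" "\<And>t. g t \<le> B"
    and zero: "\<And>t. size1 t > K \<Longrightarrow> g t = 0" and "n > K"
  shows "bst_avg n (\<lambda>t. (fringe_sum g t - fringe_density K g * real n)\<^sup>2) \<le> (4 * real K * B)\<^sup>2 * real n"
proof -
  define c where "c = fringe_density K g"
  define m where "m = (\<lambda>n. bst_avg n (fringe_sum g))"
  define W where "W = (\<lambda>t. fringe_sum g t - m (size1 t))"
  define V where "V = (\<lambda>n. bst_avg n (\<lambda>t. (W t)\<^sup>2))"
  define D where "D = 4 * real K * B"
  have "0 \<le> B" using g[of Leaf] by linarith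
  have m_eq: "m n = c * real n" if "n > K" for n
    unfolding m_def c_def using zero that by (rule bst_avg_fringe_sum_truncated)
  have m_bounds: "m n \<in> {0..2 * B * real n}" if "n > 0" for n
    unfolding m_def using that fringe_sum_bounds[of g B, OF g]
    by (auto intro!: bst_avg_nonneg bst_avg_le_const)
  have avg_g: "bst_avg k g \<in> {0..B}" if "k > 0" for k
    using that g by (auto intro!: bst_avg_nonneg bst_avg_le_const)
  have c_bounds: "c \<in> {0..2 * B}"
  proof -
    have "(\<Sum>k\<in>{1..K}. bst_avg k g / (real k * (real k + 1))) \<le> (\<Sum>k\<in>{1..<Suc K}. B * (1 / (real k * (real k + 1))))"
      unfolding atLeastLessThanSuc_atLeastAtMost
      using avg_g by (intro sum_mono) (auto simp: divide_simps)
    also have "\<dots> \<le> B"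
      unfolding sum_distrib_left[symmetric]
      using sum_inverse_product_telescope[of 1 "Suc K"] \<open>0 \<le> B\<close> by (simp add: mult_left_le)
    finally have "c \<le> 2 * B" by (simp add: c_def fringe_density_def)
    moreover have "c \<ge> 0"
      unfolding c_def fringe_density_def using avg_g by (auto intro!: sum_nonneg mult_nonneg_nonneg divide_nonneg_nonneg)
    ultimately show ?thesis by simp
  qed
  have m_diff: "\<bar>m n - c * real n\<bar> \<le> 2 * real K * B" if "n > 0" for n
  proof (cases "n > K")
    case True
    thus ?thesis using \<open>0 \<le> B\<close> by (simp add: m_eq)
  next
    case False
    have "c * real n \<in> {0..2 * B * real n}"
      using c_bounds by (auto intro: mult_right_mono)
    moreover have "2 * B * real n \<le> 2 * real K * B"
      using False \<open>0 \<le> B\<close> mult_mono[of B B "real n" "real K"] by (simp add: mult_ac)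
    ultimately show ?thesis
      using m_bounds[OF that] by auto
  qed
  have W_mean: "bst_avg n W = 0" if "n > 0" for n
  proof -
    have "bst_avg n W = bst_avg n (\<lambda>t. fringe_sum g t - m n)"
      by (intro bst_avg_cong) (simp add: W_def)
    thus ?thesis using that by (simp add: bst_avg_diff bst_avg_const m_def)
  qed
  \<comment> \<open>The \<open>- 1\<close> pays for the drift: the branches use up
    \<open>(k - 1) + (n - k - 1) = n - 2\<close>, which leaves one \<open>D\<^sup>2\<close> for
    \<open>d\<^sup>2\<close>.\<close>
  have V_le: "V n \<le> D\<^sup>2 * (real n - 1)" if "n > 0" for n
    using that
  proof (induction n rule: less_induct)
    case (less n)
    consider "n = 1" | "n \<ge> 2" "n \<le> K" | "n \<ge> 2" "n > K" using less.prems by linarith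
    thus ?case
    proof cases
      case 1
      thus ?thesis by (simp add: V_def W_def bst_avg_1 m_def)
    next
      case 2
      have "(W t)\<^sup>2 \<le> D\<^sup>2" if "size1 t = n" for t
      proof -
        have "2 * B * real n \<le> D"
          using 2 \<open>0 \<le> B\<close> mult_mono[of "2 * real n" "4 * real K" B B] by (simp add: D_def mult_ac)
        moreover have "\<bar>W t\<bar> \<le> 2 * B * real n"
          using fringe_sum_bounds[of g B t, OF g] m_bounds[of n] that less.prems by (auto simp: W_def)
        ultimately show ?thesis
          by (intro power2_le_iff_abs_le[THEN iffD2]) linarith+
      qed
      hence "V n \<le> D\<^sup>2 * 1"
        unfolding V_def using less.prems by (intro bst_avg_le_const) auto
      also have "\<dots> \<le> D\<^sup>2 * (real n - 1)"
        using 2 by (intro mult_left_mono) auto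
      finally show ?thesis .
    next
      case 3
      have split: "bst_avg k (\<lambda>l. bst_avg (n - k) (\<lambda>r. (W (Node l () r))\<^sup>2)) \<le> D\<^sup>2 * (real n - 1)"
        if k: "k \<in> {1..<n}" for k
      proof -
        define d where "d = m k + m (n - k) - m n"
        have d_eq: "d = (m k - c * real k) + (m (n - k) - c * real (n - k))"
          using k 3 by (simp add: d_def m_eq of_nat_diff algebra_simps)
        have "\<bar>d\<bar> \<le> D"
          using m_diff[of k] m_diff[of "n - k"] k unfolding d_eq D_def by auto
        hence d2: "d\<^sup>2 \<le> D\<^sup>2" using abs_le_square_iff[of d D] by auto
        have W_Node: "W (Node l () r) = W r + (W l + d)" if "size1 l = k" "size1 r = n - k" for l r
          using that k zero[of "Node l () r"] 3 by (simp add: W_def d_def)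
        have "bst_avg k (\<lambda>l. bst_avg (n - k) (\<lambda>r. (W (Node l () r))\<^sup>2)) =
              bst_avg k (\<lambda>l. bst_avg (n - k) (\<lambda>r. (W r + (W l + d))\<^sup>2))"
          by (intro bst_avg_cong) (simp add: W_Node)
        also have "\<dots> = bst_avg k (\<lambda>l. V (n - k) + (W l + d)\<^sup>2)"
          using k by (simp add: bst_avg_centered_square W_mean V_def)
        also have "\<dots> = V (n - k) + (V k + d\<^sup>2)"
          using k by (simp add: bst_avg_add bst_avg_const bst_avg_centered_square W_mean V_def)
        also have "\<dots> \<le> D\<^sup>2 * (real (n - k) - 1) + (D\<^sup>2 * (real k - 1) + D\<^sup>2)"
          using k d2 by (intro add_mono less.IH) auto
        also have "\<dots> = D\<^sup>2 * (real n - 1)"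
          using k by (simp add: of_nat_diff algebra_simps)
        finally show ?thesis .
      qed
      have "V n \<le> (\<Sum>k\<in>{1..<n}. D\<^sup>2 * (real n - 1)) / (real n - 1)"
        unfolding V_def bst_avg_rec[OF 3(1)]
        using 3 by (intro divide_right_mono sum_mono split) auto
      also have "\<dots> = D\<^sup>2 * (real n - 1)"
        using 3 by (simp add: of_nat_diff)
      finally show ?thesis .
    qed
  qed
  have "bst_avg n (\<lambda>t. (fringe_sum g t - c * real n)\<^sup>2) = V n"
    unfolding V_def W_def using \<open>n > K\<close> by (intro bst_avg_cong) (simp add: m_eq)
  also have "\<dots> \<le> D\<^sup>2 * (real n - 1)"
    using \<open>n > K\<close> by (intro V_le) auto
  also have "\<dots> \<le> D\<^sup>2 * real n"
    by (intro mult_left_mono) auto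
  finally show ?thesis by (simp add: D_def c_def)
qed

section \<open>Probabilities and repetitions of isomorphism classes\<close>

primrec usize :: "utree \<Rightarrow> nat" where
  "usize (UNode M) = (if M = {#} then 1 else sum_mset (image_mset usize M))"

lemma usize_unordered [simp]: "usize (unordered t) = size1 t"
  by (induction t) auto

definition class_prob :: "utree \<Rightarrow> real" where
  "class_prob u = bst_avg (usize u) (\<lambda>t. of_bool (unordered t = u))"

lemma bst_avg_class: "bst_avg k (\<lambda>t. of_bool (unordered t = u)) = (if k = usize u then class_prob u else 0)"
proof (cases "k = usize u")
  case False
  hence "bst_avg k (\<lambda>t. of_bool (unordered t = u)) = bst_avg k (\<lambda>t. 0)"
    by (intro bst_avg_cong) auto
  thus ?thesis using False by (simp add: bst_avg_def)
qed (simp add: class_prob_def)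

lemma class_prob_nonneg: "class_prob u \<ge> 0"
  unfolding class_prob_def by (intro bst_avg_nonneg) auto

lemma class_prob_Leaf: "class_prob (UNode {#}) = 1"
  by (simp add: class_prob_def bst_avg_1)

text \<open>Distinct branches can be arranged in two orders, equal ones in only one. A class
  determines its size, so for each order a single left size contributes to the sum over the
  splits.\<close>

lemma class_prob_Node:
  fixes l r :: btree
  shows "class_prob (unordered (Node l x r)) =
    (if unordered l = unordered r then 1 else 2) * class_prob (unordered l) * class_prob (unordered r)
      / (real (size1 l + size1 r) - 1)"
proof -
  define a b n where "a = unordered l" and "b = unordered r" and "n = size1 l + size1 r"
  have n: "n \<ge> 2"
    using size1_ge0[of l] size1_ge0[of r] unfolding n_def by linarith
  have ab: "usize a = size1 l" "usize b = size1 r" "size1 l > 0" "size1 r > 0"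
    by (simp_all add: a_def b_def)
  define q where "q = (\<lambda>k u. bst_avg k (\<lambda>t. of_bool (unordered t = u)))"
  have prod: "bst_avg k (\<lambda>s. of_bool (unordered s = u) * bst_avg j (\<lambda>t. of_bool (unordered t = v))) = q k u * q j v"
    for k j u v by (simp add: q_def bst_avg_cmult_right)
  have qq: "(\<Sum>k\<in>{1..<n}. q k u * q (n - k) v) = class_prob u * class_prob v"
    if "usize u + usize v = n" "usize u > 0" "usize v > 0" for u v
  proof -
    have "(\<Sum>k\<in>{1..<n}. q k u * q (n - k) v) = (\<Sum>k\<in>{usize u}. class_prob u * class_prob v)"
      using that by (intro sum.mono_neutral_cong_right) (auto simp: q_def bst_avg_class)
    thus ?thesis by simp
  qed
  have "class_prob (unordered (Node l x r)) = bst_avg n (\<lambda>t. of_bool (unordered t = UNode {#a, b#}))"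
    by (simp add: class_prob_def a_def b_def n_def)
  also have "\<dots> = (\<Sum>k\<in>{1..<n}. bst_avg k (\<lambda>s. bst_avg (n - k) (\<lambda>t.
      of_bool (unordered s = a) * of_bool (unordered t = b)
      + (if a = b then 0 else 1) * (of_bool (unordered s = b) * of_bool (unordered t = a))))) / (real n - 1)"
    unfolding bst_avg_rec[OF n]
    by (intro arg_cong2[where f = "(/)"] sum.cong bst_avg_cong refl) (auto simp: add_eq_conv_ex)
  also have "\<dots> = (class_prob a * class_prob b + (if a = b then 0 else 1) * (class_prob b * class_prob a)) / (real n - 1)"
    unfolding bst_avg_add bst_avg_cmult prod sum.distrib sum_distrib_left[symmetric]
    using ab by (subst (1 2) qq) (auto simp: n_def)
  finally show ?thesis
    by (simp add: a_def b_def n_def)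
qed

text \<open>Members of one class have equal size and are never nested. So either the root is the
  only copy and there is no pair, or the copies are shared out between the independent branches. As
  the mean number of copies is at most \<open>p * k\<close> in a tree of size \<open>k\<close>, the
  induction closes by
  \<open>k\<^sup>2 + (n - k)\<^sup>2 + 2 * k * (n - k) = n\<^sup>2\<close>.\<close>

lemma bst_avg_pairs:
  fixes u :: utree
  defines "N \<equiv> fringe_sum (\<lambda>s. of_bool (unordered s = u))"
  assumes "n > 0"
  shows "bst_avg n (\<lambda>t. N t * (N t - 1)) \<le> (class_prob u)\<^sup>2 * (real n)\<^sup>2"
proof -
  define p where "p = class_prob u"
  have "p \<ge> 0" by (simp add: p_def class_prob_nonneg)
  have mean: "bst_avg n N \<le> p * real n" if "n > 0" for n
  proof -
    have eq: "bst_avg n N = (if n = usize u then p else 0) +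
      2 * real n * (\<Sum>k\<in>{1..<n}. if k = usize u then p / (real k * (real k + 1)) else 0)"
      unfolding N_def using that
      by (simp only: bst_avg_fringe_sum Suc_le_eq One_nat_def bst_avg_class p_def if_distrib[of "\<lambda>x. x / _"]
            div_0 cong: if_cong)
    consider "n = usize u" | "n \<noteq> usize u" "usize u \<in> {1..<n}" | "n \<noteq> usize u" "usize u \<notin> {1..<n}" by blast
    thus ?thesis
    proof cases
      case 1
      thus ?thesis using eq that \<open>p \<ge> 0\<close> by (simp add: mult_le_cancel_left1)
    next
      case 2
      have "2 * real n * (p / (real (usize u) * (real (usize u) + 1))) \<le> 2 * real n * (p / 2)"
        using 2 \<open>p \<ge> 0\<close> mult_mono[of 1 "real (usize u)" 2 "real (usize u) + 1"]
        by (intro mult_left_mono divide_left_mono) auto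
      thus ?thesis using eq 2 by (simp add: mult_ac)
    qed (use eq \<open>p \<ge> 0\<close> in auto)
  qed
  have N_zero: "N t = 0" if "size1 t < usize u" for t
    using that by (induction t) (auto simp: N_def)
  have N_Node: "N (Node l x r) * (N (Node l x r) - 1) = N l * (N l - 1) + N r * (N r - 1) + 2 * (N l * N r)" for l x r
  proof (cases "unordered (Node l x r) = u")
    case True
    have "size1 l < usize u" "size1 r < usize u"
      unfolding True[symmetric] usize_unordered by simp_all
    hence "N l = 0" "N r = 0" by (simp_all add: N_zero)
    thus ?thesis using True by (simp add: N_def)
  next
    case False
    hence "N (Node l x r) = N l + N r" by (simp add: N_def)
    thus ?thesis by (simp add: algebra_simps)
  qed
  define Q where "Q = (\<lambda>n. bst_avg n (\<lambda>t. N t * (N t - 1)))"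
  have "Q n \<le> p\<^sup>2 * (real n)\<^sup>2"
    using \<open>n > 0\<close>
  proof (induction n rule: less_induct)
    case (less n)
    show ?case
    proof (cases "n = 1")
      case True
      thus ?thesis by (simp add: Q_def bst_avg_1 N_def)
    next
      case False
      with less.prems have n: "n \<ge> 2" by simp
      have split: "bst_avg k (\<lambda>l. bst_avg (n - k) (\<lambda>r. N (Node l () r) * (N (Node l () r) - 1))) \<le> p\<^sup>2 * (real n)\<^sup>2"
        if k: "k \<in> {1..<n}" for k
      proof -
        have N_nonneg: "bst_avg j N \<ge> 0" for j
          unfolding N_def by (intro bst_avg_nonneg fringe_sum_nonneg) auto
        have "bst_avg k (\<lambda>l. bst_avg (n - k) (\<lambda>r. N (Node l () r) * (N (Node l () r) - 1))) =
              Q k + Q (n - k) + 2 * (bst_avg k N * bst_avg (n - k) N)"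
          unfolding N_Node Q_def using k
          by (simp add: bst_avg_add bst_avg_const bst_avg_cmult bst_avg_cmult_right)
        also have "\<dots> \<le> p\<^sup>2 * (real k)\<^sup>2 + p\<^sup>2 * (real (n - k))\<^sup>2 + 2 * ((p * real k) * (p * real (n - k)))"
          using k \<open>p \<ge> 0\<close> N_nonneg by (intro add_mono less.IH mult_left_mono mult_mono mean) auto
        also have "\<dots> = p\<^sup>2 * (real k + real (n - k))\<^sup>2"
          by (simp add: power2_eq_square algebra_simps)
        also have "real k + real (n - k) = real n" using k by (simp add: of_nat_diff)
        finally show ?thesis .
      qed
      have "Q n \<le> (\<Sum>k\<in>{1..<n}. p\<^sup>2 * (real n)\<^sup>2) / (real n - 1)"
        unfolding Q_def bst_avg_rec[OF n]
        using n by (intro divide_right_mono sum_mono split) auto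
      also have "\<dots> = p\<^sup>2 * (real n)\<^sup>2"
        using n by (simp add: of_nat_diff)
      finally show ?thesis .
    qed
  qed
  thus ?thesis by (simp add: Q_def p_def)
qed

fun symmetric_root :: "'a tree \<Rightarrow> bool" where
  "symmetric_root Leaf \<longleftrightarrow> False"
| "symmetric_root (Node l x r) \<longleftrightarrow> unordered l = unordered r"

text \<open>Truncating the toll at size \<open>K\<close> keeps it bounded; the entropy is recovered as \<open>K \<rightarrow> \<infinity>\<close>.\<close>

definition entropy_toll :: "nat \<Rightarrow> btree \<Rightarrow> real" where
  "entropy_toll K t = (if size1 t \<in> {2..K} then ln (real (size1 t) - 1) + ln 2 * of_bool (symmetric_root t) else 0)"

lemma entropy_toll_bounds: "entropy_toll K t \<in> {0..ln (real (Suc K)) + ln 2}"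
proof -
  have *: "0 \<le> ln (real (Suc K))" "0 \<le> ln (2::real)" by (intro ln_ge_zero; simp)+
  show ?thesis
  proof (cases "size1 t \<in> {2..K}")
    case True
    have "0 \<le> ln (real (size1 t) - 1)" "ln (real (size1 t) - 1) \<le> ln (real (Suc K))"
      using True by (auto intro!: ln_ge_zero ln_mono)
    moreover have "0 \<le> ln (2::real) * of_bool (symmetric_root t)" "ln 2 * of_bool (symmetric_root t) \<le> ln (2::real)"
      by auto
    moreover have "entropy_toll K t = ln (real (size1 t) - 1) + ln 2 * of_bool (symmetric_root t)"
      by (simp only: entropy_toll_def True if_True)
    ultimately show ?thesis unfolding atLeastAtMost_iff by linarith
  next
    case False
    thus ?thesis using * unfolding entropy_toll_def by auto
  qed
qed

text \<open>This is \<open>class_prob_Node\<close> multiplied out over the inner nodes. Up to size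
  \<open>K\<close> the toll reproduces the factor of a node exactly; at larger nodes the factor is
  merely estimated by \<open>2\<close>.\<close>

lemma class_prob_le_exp:
  "class_prob (unordered t) \<le> exp (ln 2 * (real (size1 t) - 1) - fringe_sum (entropy_toll K) t)"
proof (induction t)
  case Leaf
  thus ?case by (simp add: class_prob_Leaf entropy_toll_def)
next
  case (Node l x r)
  define t where "t = Node l x r"
  have n: "real (size1 l + size1 r) - 1 \<ge> 1"
    using size1_ge0[of l] size1_ge0[of r] by linarith
  define c where "c = (if unordered l = unordered r then 1 else 2 :: real) / (real (size1 l + size1 r) - 1)"
  have "c \<ge> 0" using n by (auto simp: c_def)
  have c: "c \<le> exp (ln 2 - entropy_toll K t)"
  proof (cases "size1 t \<in> {2..K}")
    case True
    thus ?thesis using n by (auto simp: t_def c_def entropy_toll_def exp_diff exp_add divide_simps)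
  next
    case False
    have "c \<le> 2 / 1" unfolding c_def using n by (intro frac_le) auto
    moreover have "entropy_toll K t = 0"
      by (simp only: entropy_toll_def False if_False)
    ultimately show ?thesis by simp
  qed
  have "class_prob (unordered t) = c * (class_prob (unordered l) * class_prob (unordered r))"
    unfolding t_def class_prob_Node c_def by simp
  also have "\<dots> \<le> exp (ln 2 - entropy_toll K t) *
      (exp (ln 2 * (real (size1 l) - 1) - fringe_sum (entropy_toll K) l)
        * exp (ln 2 * (real (size1 r) - 1) - fringe_sum (entropy_toll K) r))"
    using c \<open>c \<ge> 0\<close> Node by (intro mult_mono mult_nonneg_nonneg class_prob_nonneg) auto
  also have "\<dots> = exp (ln 2 * (real (size1 t) - 1) - fringe_sum (entropy_toll K) t)"
    by (simp add: t_def algebra_simps flip: exp_add)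
  finally show ?case by (simp add: t_def)
qed

definition atypical :: "real \<Rightarrow> btree \<Rightarrow> bool" where
  "atypical \<theta> t \<longleftrightarrow> class_prob (unordered t) > exp (- (\<theta> * real (size1 t)))"

text \<open>By \<open>class_prob_le_exp\<close>, an atypical tree has a toll sum at least
  \<open>\<epsilon> * n\<close> below its mean. For the fixed \<open>K\<close> the variance is
  \<open>O(n)\<close>, so Chebyshev's inequality gives \<open>O(1 / n)\<close>.\<close>

lemma atypical_rare:
  assumes "fringe_density K (entropy_toll K) - ln 2 > \<theta>"
  shows "(\<lambda>n. bst_avg n (\<lambda>t. of_bool (atypical \<theta> t))) \<longlonglongrightarrow> 0"
proof -
  define c where "c = fringe_density K (entropy_toll K)"
  define \<epsilon> where "\<epsilon> = c - ln 2 - \<theta>"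
  have "\<epsilon> > 0" using assms by (simp add: \<epsilon>_def c_def)
  define D where "D = 4 * real K * (ln (real (Suc K)) + ln 2)"
  have bound: "bst_avg n (\<lambda>t. of_bool (atypical \<theta> t)) \<le> D\<^sup>2 / \<epsilon>\<^sup>2 * (1 / real n)" if "n > K" for n
  proof -
    have "of_bool (atypical \<theta> t) \<le> (fringe_sum (entropy_toll K) t - c * real n)\<^sup>2 / (\<epsilon> * real n)\<^sup>2"
      if t: "size1 t = n" for t
    proof (cases "atypical \<theta> t")
      case True
      have "exp (- (\<theta> * real n)) < exp (ln 2 * (real n - 1) - fringe_sum (entropy_toll K) t)"
        using less_le_trans[OF _ class_prob_le_exp[of t K]] True t by (auto simp: atypical_def)
      hence "- (\<theta> * real n) < ln 2 * (real n - 1) - fringe_sum (entropy_toll K) t"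
        by simp
      moreover have "(ln 2 :: real) \<ge> 0" by simp
      moreover have "ln 2 * (real n - 1) = ln 2 * real n - ln (2 :: real)" "\<epsilon> * real n = c * real n - ln 2 * real n - \<theta> * real n"
        by (simp_all add: \<epsilon>_def algebra_simps)
      ultimately have "fringe_sum (entropy_toll K) t - c * real n \<le> - (\<epsilon> * real n)"
        by linarith
      hence "(\<epsilon> * real n)\<^sup>2 \<le> (fringe_sum (entropy_toll K) t - c * real n)\<^sup>2"
        using \<open>\<epsilon> > 0\<close> by (intro abs_le_square_iff[THEN iffD1]) auto
      thus ?thesis using True \<open>\<epsilon> > 0\<close> \<open>n > K\<close> by (simp add: divide_simps)
    qed auto
    hence "bst_avg n (\<lambda>t. of_bool (atypical \<theta> t)) \<le>
           bst_avg n (\<lambda>t. (fringe_sum (entropy_toll K) t - c * real n)\<^sup>2 / (\<epsilon> * real n)\<^sup>2)"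
      by (rule bst_avg_mono)
    also have "\<dots> \<le> (D\<^sup>2 * real n) / (\<epsilon> * real n)\<^sup>2"
      unfolding bst_avg_divide D_def c_def using entropy_toll_bounds[of K] \<open>n > K\<close>
      by (intro divide_right_mono bst_variance) (auto simp: entropy_toll_def)
    also have "\<dots> = D\<^sup>2 / \<epsilon>\<^sup>2 * (1 / real n)"
      using \<open>n > K\<close> by (simp add: power2_eq_square)
    finally show ?thesis .
  qed
  show ?thesis
  proof (rule tendsto_sandwich)
    show "\<forall>\<^sub>F n in sequentially. 0 \<le> bst_avg n (\<lambda>t. of_bool (atypical \<theta> t))"
      by (intro always_eventually allI bst_avg_nonneg) auto
    show "\<forall>\<^sub>F n in sequentially. bst_avg n (\<lambda>t. of_bool (atypical \<theta> t)) \<le> D\<^sup>2 / \<epsilon>\<^sup>2 * (1 / real n)"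
      using eventually_gt_at_top[of K] by eventually_elim (rule bound)
    show "(\<lambda>n. D\<^sup>2 / \<epsilon>\<^sup>2 * (1 / real n)) \<longlonglongrightarrow> 0"
      by (intro tendsto_mult_right_zero lim_1_over_n)
  qed auto
qed

section \<open>The number of unordered binary trees\<close>

definition unordered_upto :: "nat \<Rightarrow> utree set" where
  "unordered_upto N = unordered ` {t :: btree. size1 t \<le> N}"

lemma finite_unordered_upto: "finite (unordered_upto N)"
proof -
  have "{t :: btree. size1 t \<le> N} = (\<Union>k\<le>N. {t. size1 t = k})" by auto
  thus ?thesis
    unfolding unordered_upto_def by (simp add: finite_trees_size1)
qed

text \<open>A polynomial section of the generating function \<open>f\<close>. Bounds uniform in
  \<open>N\<close> take the place of statements about convergence.\<close>

definition utree_gf :: "nat \<Rightarrow> real \<Rightarrow> real" where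
  "utree_gf N x = (\<Sum>u\<in>unordered_upto N. x ^ usize u)"

lemma utree_gf_mono: "0 \<le> x \<Longrightarrow> x \<le> y \<Longrightarrow> utree_gf N x \<le> utree_gf N y"
  unfolding utree_gf_def by (intro sum_mono power_mono)

lemma utree_gf_nonneg: "0 \<le> x \<Longrightarrow> 0 \<le> utree_gf N x"
  unfolding utree_gf_def by (intro sum_nonneg) auto

lemma utree_gf_0 [simp]: "utree_gf 0 x = 0"
  by (simp add: utree_gf_def unordered_upto_def size1_size)

text \<open>Truncated form of the functional equation \<open>f(x) = x + (f(x)\<^sup>2 + f(x\<^sup>2)) / 2\<close> of the
  Wedderburn--Etherington numbers.\<close>

lemma utree_gf_Suc_le:
  assumes "0 \<le> x"
  shows "utree_gf (Suc N) x \<le> x + ((utree_gf N x)\<^sup>2 + utree_gf N (x\<^sup>2)) / 2"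
proof -
  define W where "W = unordered_upto N"
  define \<phi> where "\<phi> = (\<lambda>(a, b). UNode {#a, b#})"
  define V where "V = \<phi> ` (W \<times> W)"
  define h where "h = (\<lambda>u. x ^ usize u)"
  have fin: "finite W" "finite V"
    by (simp_all add: W_def V_def finite_unordered_upto)
  have h_nonneg: "h u \<ge> 0" for u using assms by (simp add: h_def)
  have "unordered_upto (Suc N) \<subseteq> insert (UNode {#}) V"
  proof
    fix u assume "u \<in> unordered_upto (Suc N)"
    then obtain t :: btree where t: "u = unordered t" "size1 t \<le> Suc N"
      by (auto simp: unordered_upto_def)
    show "u \<in> insert (UNode {#}) V"
    proof (cases t)
      case (Node l x r)
      have "0 < size1 l" "0 < size1 r" by simp_all
      moreover have "size1 l + size1 r \<le> Suc N" using t Node by simp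
      ultimately have "size1 l \<le> N" "size1 r \<le> N" by linarith+
      thus ?thesis using t Node by (auto simp: V_def W_def unordered_upto_def \<phi>_def)
    qed (use t in auto)
  qed
  hence "utree_gf (Suc N) x \<le> (\<Sum>u\<in>insert (UNode {#}) V. h u)"
    unfolding utree_gf_def h_def using fin assms by (intro sum_mono2) auto
  also have "\<dots> \<le> x + (\<Sum>u\<in>V. h u)"
    using fin h_nonneg[of "UNode {#}"] by (cases "UNode {#} \<in> V") (auto simp: insert_absorb h_def assms)
  finally have Suc_le: "utree_gf (Suc N) x \<le> x + (\<Sum>u\<in>V. h u)" .
  \<comment> \<open>Each class is counted twice on the right: distinct branches give two ordered
    pairs, equal branches one pair and one diagonal term.\<close>
  have "2 * (\<Sum>u\<in>V. h u) \<le> (\<Sum>u\<in>V. (\<Sum>z | z \<in> W \<times> W \<and> \<phi> z = u. h (fst z) * h (snd z))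
                                   + (\<Sum>a | a \<in> W \<and> \<phi> (a, a) = u. (h a)\<^sup>2))"
    unfolding sum_distrib_left
  proof (rule sum_mono)
    fix u assume "u \<in> V"
    then obtain a b where ab: "a \<in> W" "b \<in> W" "u = \<phi> (a, b)" by (auto simp: V_def)
    have hu: "h u = h a * h b"
      by (simp add: ab \<phi>_def h_def power_add)
    show "2 * h u \<le> (\<Sum>z | z \<in> W \<times> W \<and> \<phi> z = u. h (fst z) * h (snd z))
                      + (\<Sum>a | a \<in> W \<and> \<phi> (a, a) = u. (h a)\<^sup>2)"
    proof (cases "a = b")
      case False
      have "2 * h u = (\<Sum>z\<in>{(a, b), (b, a)}. h (fst z) * h (snd z))"
        using False by (simp add: hu)
      also have "\<dots> \<le> (\<Sum>z | z \<in> W \<times> W \<and> \<phi> z = u. h (fst z) * h (snd z))"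
        using ab fin h_nonneg by (intro sum_mono2) (auto simp: \<phi>_def add_mset_commute)
      finally show ?thesis
        by (simp add: add_increasing2 sum_nonneg)
    next
      case True
      have "(\<Sum>z\<in>{(a, a)}. h (fst z) * h (snd z)) \<le> (\<Sum>z | z \<in> W \<times> W \<and> \<phi> z = u. h (fst z) * h (snd z))"
        using ab True fin h_nonneg by (intro sum_mono2) auto
      moreover have "(\<Sum>a\<in>{a}. (h a)\<^sup>2) \<le> (\<Sum>a | a \<in> W \<and> \<phi> (a, a) = u. (h a)\<^sup>2)"
        using ab True fin h_nonneg by (intro sum_mono2) auto
      ultimately show ?thesis
        using True by (simp add: hu power2_eq_square)
    qed
  qed
  also have "\<dots> = (\<Sum>z\<in>W \<times> W. h (fst z) * h (snd z)) + (\<Sum>a\<in>W. (h a)\<^sup>2)"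
    unfolding sum.distrib using fin
    by (intro arg_cong2[where f = "(+)"] sum.group) (auto simp: V_def)
  also have "(\<Sum>z\<in>W \<times> W. h (fst z) * h (snd z)) = (\<Sum>u\<in>W. h u)\<^sup>2"
    by (simp add: power2_eq_square sum_product sum.cartesian_product case_prod_unfold)
  also have "(\<Sum>u\<in>W. h u) = utree_gf N x"
    by (simp add: utree_gf_def W_def h_def)
  also have "(\<Sum>a\<in>W. (h a)\<^sup>2) = utree_gf N (x\<^sup>2)"
    by (simp add: utree_gf_def W_def h_def flip: power_mult) (simp add: mult.commute)
  finally show ?thesis using Suc_le by (simp add: field_simps)
qed

text \<open>The recursion turns the bound \<open>2 * x\<close> into
  \<open>x + 3 * x\<^sup>2\<close>, which is again at most \<open>2 * x\<close> for
  \<open>x \<le> 1 / 3\<close>; the square of \<open>x\<close> stays in the same range.\<close>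

lemma utree_gf_small:
  assumes "0 \<le> x" "x \<le> 1 / 3"
  shows "utree_gf N x \<le> 2 * x"
  using assms
proof (induction N arbitrary: x)
  case (Suc N)
  have sq: "x\<^sup>2 \<le> x / 3"
    using mult_left_mono[OF Suc.prems(2) Suc.prems(1)] by (simp add: power2_eq_square)
  have "(utree_gf N x)\<^sup>2 \<le> (2 * x)\<^sup>2"
    using Suc by (intro power_mono utree_gf_nonneg) auto
  moreover have "utree_gf N (x\<^sup>2) \<le> 2 * x\<^sup>2"
    using Suc.prems sq by (intro Suc.IH) auto
  ultimately have "utree_gf (Suc N) x \<le> x + 3 * x\<^sup>2"
    using utree_gf_Suc_le[OF Suc.prems(1), of N] by (simp add: power_mult_distrib field_simps)
  thus ?case using sq by linarith
qed auto

text \<open>\<open>A\<close> is mapped to at most itself by the monotone map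
  \<open>g \<mapsto> x + (g\<^sup>2 + B) / 2\<close>, so the iteration, which starts at
  \<open>0\<close>, cannot pass it.\<close>

lemma utree_gf_bound_step:
  assumes "\<And>N. utree_gf N y \<le> B" "0 \<le> x" "x\<^sup>2 \<le> y" "0 \<le> A" "x + (A\<^sup>2 + B) / 2 \<le> A"
  shows "utree_gf N x \<le> A"
proof (induction N)
  case (Suc N)
  have "(utree_gf N x)\<^sup>2 \<le> A\<^sup>2"
    using Suc assms by (intro power_mono utree_gf_nonneg)
  moreover have "utree_gf N (x\<^sup>2) \<le> B"
    using utree_gf_mono[of "x\<^sup>2" y N] assms(1)[of N] assms(3) by simp
  ultimately show ?case
    using utree_gf_Suc_le[OF assms(2), of N] assms(5) by (simp add: field_simps)
qed (use assms in auto)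

text \<open>Any \<open>x\<close> with \<open>x + f(x\<^sup>2) / 2 \<le> 1 / 2\<close> lies in the disc of convergence. The values \<open>f(x\<^bsup>2^k\<^esup>)\<close>
  are bounded by descending \<open>k\<close>, using \<open>f(y) \<le> 2 y\<close> for the smallest argument.\<close>

lemma utree_gf_le_1: "utree_gf N 0.40269750365 \<le> 1"
proof -
  \<comment> \<open>The arguments are the iterated squares of \<open>0.40269750365\<close>, rounded
    up. From the second line on, each bound is the smaller root of
    \<open>A = x + (A\<^sup>2 + B) / 2\<close>, rounded up. At the radius of convergence the two
    roots meet at \<open>A = 1\<close>, the value used in the last step.\<close>
  have "utree_gf N 0.000000000000229 \<le> 0.000000000000458" for N
    using utree_gf_small[of "0.000000000000229"] by simp
  hence "utree_gf N 0.000000478258832 \<le> 0.000000478259177" for N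
    by (rule utree_gf_bound_step) (simp_all add: power2_eq_square)
  hence "utree_gf N 0.000691562601187 \<le> 0.000692041191282" for N
    by (rule utree_gf_bound_step) (simp_all add: power2_eq_square)
  hence "utree_gf N 0.026297577857781 \<le> 0.027008323214863" for N
    by (rule utree_gf_bound_step) (simp_all add: power2_eq_square)
  hence "utree_gf N 0.162165279445942 \<le> 0.194604992632031" for N
    by (rule utree_gf_bound_step) (simp_all add: power2_eq_square)
  thus ?thesis
    by (rule utree_gf_bound_step) (simp_all add: power2_eq_square)
qed

lemma exp_ge_Taylor:
  fixes x :: real
  assumes "0 \<le> x"
  shows "(\<Sum>k<n. x ^ k / fact k) \<le> exp x"
proof -
  have "(\<Sum>k<n. x ^ k /\<^sub>R fact k) \<le> exp x"
    unfolding exp_def using assms summable_exp_generic[of x] by (intro sum_le_suminf) auto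
  thus ?thesis by (simp add: field_simps)
qed

text \<open>Allows rounding down after every Taylor term, so that no high power of a long decimal is
  computed exactly.\<close>

lemma exp_term_step:
  fixes x :: real
  assumes "a \<le> x ^ k / fact k" "0 \<le> x" "n = Suc k" "b \<le> a * x / real n"
  shows "b \<le> x ^ n / fact n"
proof -
  have "a * x / real n \<le> x ^ k / fact k * x / real n"
    using assms by (intro divide_right_mono mult_right_mono) auto
  also have "\<dots> = x ^ n / fact n"
    using assms(3) by (simp add: divide_simps)
  finally show ?thesis using assms(4) by linarith
qed

lemma ln_utree_radius: "- 2 * ln (0.40269750365 :: real) < 1.81913922039"
proof -
  \<comment> \<open>Half of the claimed bound. It remains to show
    \<open>exp x > 1 / 0.40269750365\<close>, from sixteen Taylor terms rounded down to thirteen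
    decimals.\<close>
  define x :: real where "x = 0.909569610195"
  define y where "y = (\<lambda>k. x ^ k / fact k)"
  have x: "0 \<le> x" by (simp add: x_def)
  have step: "b \<le> y n" if "a \<le> y k" "n = Suc k" "b \<le> a * x / real n" for a b k n
    using exp_term_step[of a x k n b] that x by (simp add: y_def)
  have t0: "1 \<le> y 0" by (simp add: y_def)
  have t1: "0.9095696101950 \<le> y 1"
    by (rule step[OF t0]) (simp_all add: x_def)
  have t2: "0.4136584378951 \<le> y 2"
    by (rule step[OF t1]) (simp_all add: x_def)
  have t3: "0.1254170480367 \<le> y 3"
    by (rule step[OF t2]) (simp_all add: x_def)
  have t4: "0.0285188838736 \<le> y 4"
    by (rule step[OF t3]) (simp_all add: x_def)
  have t5: "0.0051879820176 \<le> y 5"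
    by (rule step[OF t4]) (simp_all add: x_def)
  have t6: "0.0007864717969 \<le> y 6"
    by (rule step[OF t5]) (simp_all add: x_def)
  have t7: "0.0001021929779 \<le> y 7"
    by (rule step[OF t6]) (simp_all add: x_def)
  have t8: "0.0000116189533 \<le> y 8"
    by (rule step[OF t7]) (simp_all add: x_def)
  have t9: "0.0000011742496 \<le> y 9"
    by (rule step[OF t8]) (simp_all add: x_def)
  have t10: "0.0000001068061 \<le> y 10"
    by (rule step[OF t9]) (simp_all add: x_def)
  have t11: "0.0000000088315 \<le> y 11"
    by (rule step[OF t10]) (simp_all add: x_def)
  have t12: "0.0000000006694 \<le> y 12"
    by (rule step[OF t11]) (simp_all add: x_def)
  have t13: "0.0000000000468 \<le> y 13"
    by (rule step[OF t12]) (simp_all add: x_def)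
  have t14: "0.0000000000030 \<le> y 14"
    by (rule step[OF t13]) (simp_all add: x_def)
  have t15: "0.0000000000001 \<le> y 15"
    by (rule step[OF t14]) (simp_all add: x_def)
  have "1 / (0.40269750365 :: real) < (\<Sum>k<16. y k)"
    using t0 t1 t2 t3 t4 t5 t6 t7 t8 t9 t10 t11 t12 t13 t14 t15 by (simp add: lessThan_nat_numeral)
  also have "\<dots> \<le> exp x"
    unfolding y_def by (rule exp_ge_Taylor) (rule x)
  finally have "ln (1 / (0.40269750365 :: real)) < x"
    using ln_less_cancel_iff[of "1 / 0.40269750365 :: real" "exp x"] by simp
  thus ?thesis by (simp add: ln_div x_def)
qed

text \<open>As \<open>z \<le> 1\<close>, every class of size at most \<open>N\<close> contributes at
  least \<open>z ^ N\<close> to \<open>utree_gf N z \<le> 1\<close>.\<close>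

lemma card_unordered_upto: "real (card (unordered_upto N)) \<le> (1 / 0.40269750365) ^ N"
proof -
  define z :: real where "z = 0.40269750365"
  have z: "0 < z" "z \<le> 1" by (simp_all add: z_def)
  have "real (card (unordered_upto N)) * z ^ N = (\<Sum>u\<in>unordered_upto N. z ^ N)"
    by simp
  also have "\<dots> \<le> utree_gf N z"
    unfolding utree_gf_def using z by (intro sum_mono power_decreasing) (auto simp: unordered_upto_def)
  also have "\<dots> \<le> 1" unfolding z_def by (rule utree_gf_le_1)
  finally show ?thesis
    using z unfolding z_def[symmetric] by (simp add: field_simps)
qed

section \<open>The entropy rate\<close>

text \<open>Equivalently, the sum of \<open>p ^ (e + 1)\<close> over the classes of size
  \<open>n\<close>. Order \<open>1\<close> is the probability that two independent random trees are
  isomorphic.\<close>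

definition class_moment :: "nat \<Rightarrow> nat \<Rightarrow> real" where
  "class_moment e n = bst_avg n (\<lambda>t. class_prob (unordered t) ^ e)"

lemma class_moment_nonneg: "class_moment e n \<ge> 0"
  unfolding class_moment_def by (intro bst_avg_nonneg zero_le_power class_prob_nonneg)

lemma class_moment_single: "class_moment e (Suc 0) = 1"
  by (simp add: class_moment_def bst_avg_1 class_prob_Leaf)

text \<open>For fixed \<open>l\<close> of size \<open>k\<close>, a random \<open>r\<close> matches
  with probability \<open>class_prob (unordered l)\<close>, which brings in one more factor.\<close>

lemma bst_avg_isomorphic:
  "bst_avg j (\<lambda>l. bst_avg k (\<lambda>r. of_bool (unordered l = unordered r) * f (unordered l))) =
     (if j = k then bst_avg j (\<lambda>l. class_prob (unordered l) * f (unordered l)) else 0)"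
proof -
  have "bst_avg j (\<lambda>l. bst_avg k (\<lambda>r. of_bool (unordered l = unordered r) * f (unordered l))) =
        bst_avg j (\<lambda>l. if j = k then class_prob (unordered l) * f (unordered l) else 0)"
  proof (rule bst_avg_cong)
    fix l :: btree assume l: "size1 l = j"
    have flip: "(\<lambda>r. of_bool (unordered l = unordered r) :: real) = (\<lambda>r. of_bool (unordered r = unordered l))"
      by (intro ext arg_cong[where f = of_bool]) (rule eq_commute)
    show "bst_avg k (\<lambda>r. of_bool (unordered l = unordered r) * f (unordered l)) =
          (if j = k then class_prob (unordered l) * f (unordered l) else 0)"
      unfolding bst_avg_cmult_right flip bst_avg_class using l by auto
  qed
  thus ?thesis by (simp add: bst_avg_def)
qed

lemma bst_avg_symmetric_root:
  assumes "j \<ge> 1"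
  shows "bst_avg (2 * j) (\<lambda>t. of_bool (symmetric_root t)) = class_moment 1 j / (2 * real j - 1)"
proof -
  have "(\<Sum>k\<in>{1..<2*j}. bst_avg k (\<lambda>l. bst_avg (2 * j - k) (\<lambda>r. of_bool (symmetric_root (Node l () r))))) =
        (\<Sum>k\<in>{1..<2*j}. if k = 2 * j - k then class_moment 1 k else 0)"
    using bst_avg_isomorphic[where f = "\<lambda>_. 1"] by (intro sum.cong refl) (simp add: class_moment_def)
  also have "\<dots> = (\<Sum>k\<in>{j}. class_moment 1 k)"
    using assms by (intro sum.mono_neutral_cong_right) auto
  finally show ?thesis
    using assms by (subst bst_avg_rec) auto
qed

text \<open>The class of \<open>Node l () r\<close> has probability \<open>2 p\<^sub>l p\<^sub>r / (n - 1)\<close>, except for symmetric roots, where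
  the factor \<open>2\<close> is missing and which contribute the moment of order \<open>2 e + 1\<close> at \<open>n / 2\<close>.\<close>

lemma class_moment_rec:
  assumes "n \<ge> 2"
  shows "class_moment e n * (real n - 1) ^ Suc e =
    2 ^ e * (\<Sum>k\<in>{1..<n}. class_moment e k * class_moment e (n - k))
      - (if even n then (2 ^ e - 1) * class_moment (2 * e + 1) (n div 2) else 0)"
proof -
  define p where "p = (\<lambda>t :: btree. class_prob (unordered t))"
  define Y where "Y = (if even n then class_moment (2 * e + 1) (n div 2) else 0)"
  have n: "real n - 1 > 0" using assms by auto
  have "(\<Sum>k\<in>{1..<n}. bst_avg k (\<lambda>l. bst_avg (n - k) (\<lambda>r. p (Node l () r) ^ e))) =
        (\<Sum>k\<in>{1..<n}. bst_avg k (\<lambda>l. bst_avg (n - k) (\<lambda>r.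
            2 ^ e / (real n - 1) ^ e * (p l ^ e * p r ^ e)
            - (2 ^ e - 1) / (real n - 1) ^ e * (of_bool (unordered l = unordered r) * p l ^ (2 * e)))))"
  proof (intro sum.cong bst_avg_cong refl)
    fix k and l r :: btree
    assume "k \<in> {1..<n}" "size1 l = k" "size1 r = n - k"
    hence "real (size1 l + size1 r) = real n" by (simp add: of_nat_diff)
    thus "p (Node l () r) ^ e = 2 ^ e / (real n - 1) ^ e * (p l ^ e * p r ^ e)
            - (2 ^ e - 1) / (real n - 1) ^ e * (of_bool (unordered l = unordered r) * p l ^ (2 * e))"
      using n unfolding p_def class_prob_Node
      by (simp add: power_mult_distrib power_divide divide_simps flip: power_add)
         (simp add: mult_2 mult_2_right algebra_simps power_add)
  qed
  also have "\<dots> = (\<Sum>k\<in>{1..<n}. 2 ^ e / (real n - 1) ^ e * (class_moment e k * class_moment e (n - k))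
            - (2 ^ e - 1) / (real n - 1) ^ e * (if k = n - k then class_moment (2 * e + 1) k else 0))"
  proof (intro sum.cong refl)
    fix k
    have mom: "bst_avg k (\<lambda>l. class_prob (unordered l) * class_prob (unordered l) ^ (2 * e)) = class_moment (2 * e + 1) k"
      by (simp add: class_moment_def)
    show "bst_avg k (\<lambda>l. bst_avg (n - k) (\<lambda>r. 2 ^ e / (real n - 1) ^ e * (p l ^ e * p r ^ e)
            - (2 ^ e - 1) / (real n - 1) ^ e * (of_bool (unordered l = unordered r) * p l ^ (2 * e)))) =
        2 ^ e / (real n - 1) ^ e * (class_moment e k * class_moment e (n - k))
            - (2 ^ e - 1) / (real n - 1) ^ e * (if k = n - k then class_moment (2 * e + 1) k else 0)"
      unfolding bst_avg_diff bst_avg_cmult p_def mom bst_avg_isomorphic[where f = "\<lambda>u. class_prob u ^ (2 * e)"]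
      unfolding bst_avg_cmult_right class_moment_def[of e] by (rule refl)
  qed
  also have "\<dots> = 2 ^ e / (real n - 1) ^ e * (\<Sum>k\<in>{1..<n}. class_moment e k * class_moment e (n - k))
            - (2 ^ e - 1) / (real n - 1) ^ e * (\<Sum>k\<in>{1..<n}. if k = n - k then class_moment (2 * e + 1) k else 0)"
    by (simp only: sum_subtractf sum_distrib_left)
  also have "(\<Sum>k\<in>{1..<n}. if k = n - k then class_moment (2 * e + 1) k else 0) =
             (if even n then class_moment (2 * e + 1) (n div 2) else 0)"
  proof (cases "even n")
    case True
    hence "(\<Sum>k\<in>{1..<n}. if k = n - k then class_moment (2 * e + 1) k else 0) =
           (\<Sum>k\<in>{n div 2}. class_moment (2 * e + 1) k)"
      using assms by (intro sum.mono_neutral_cong_right) auto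
    thus ?thesis using True by simp
  next
    case False
    hence "k \<noteq> n - k" if "k \<in> {1..<n}" for k
      using that by presburger
    thus ?thesis using False by (intro trans[OF sum.neutral]) auto
  qed
  also have "\<dots> = Y" by (simp add: Y_def)
  finally have "class_moment e n = (2 ^ e / (real n - 1) ^ e * (\<Sum>k\<in>{1..<n}. class_moment e k * class_moment e (n - k))
      - (2 ^ e - 1) / (real n - 1) ^ e * Y) / (real n - 1)"
    unfolding class_moment_def[of e n] p_def by (simp add: bst_avg_rec[OF assms])
  moreover have "(if even n then (2 ^ e - 1) * class_moment (2 * e + 1) (n div 2) else 0) = (2 ^ e - 1) * Y"
    by (simp add: Y_def)
  ultimately show ?thesis
    using n by (simp add: field_simps)
qed

lemma sum_list_upt: "(\<Sum>k\<leftarrow>[a..<b]. f k) = (\<Sum>k\<in>{a..<b}. f k)"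
  by (simp add: interv_sum_list_conv_sum_set_nat)

text \<open>\<open>class_moment_rec\<close> multiplied by \<open>S\<^sup>2\<close> becomes an
  inequality between integers; \<open>check\<close> states it over lists so that it can be
  evaluated. The sign condition on \<open>L\<close> makes the products monotone.\<close>

lemma class_moment_lower:
  fixes L U :: "nat \<Rightarrow> int" and S :: int
  assumes "S > 0" "\<forall>n\<in>set [1..<Suc N]. L n \<ge> 0" "L 1 \<le> S"
    and U: "\<And>n. n \<ge> 1 \<Longrightarrow> 2 * n \<le> N \<Longrightarrow> class_moment (2 * e + 1) n \<le> U n / S"
    and check: "\<forall>n\<in>set [2..<Suc N]. L n * S * (int n - 1) ^ Suc e \<le>
      2 ^ e * (\<Sum>k\<leftarrow>[1..<n]. L k * L (n - k)) - (if even n then (2 ^ e - 1) * (S * U (n div 2)) else 0)"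
    and "n \<ge> 1" "n \<le> N"
  shows "L n / S \<le> class_moment e n"
  using assms(6,7)
proof (induction n rule: less_induct)
  case (less n)
  have S: "real_of_int S > 0" using \<open>S > 0\<close> by simp
  show ?case
  proof (cases "n = 1")
    case True
    thus ?thesis using assms S by (simp add: class_moment_single)
  next
    case False
    with less.prems have n: "n \<ge> 2" by simp
    have n': "n \<in> set [2..<Suc N]" using n less.prems by auto
    define b where "b = (if even n then (2 ^ e - 1) * (S * U (n div 2)) else 0)"
    have LE: "real_of_int (L n * S * (int n - 1) ^ Suc e) \<le> real_of_int (2 ^ e * (\<Sum>k\<in>{1..<n}. L k * L (n - k)) - b)"
      using bspec[OF check n'] unfolding b_def sum_list_upt by (intro of_int_le_iff[THEN iffD2])
    have "(\<Sum>k\<in>{1..<n}. (L k / S) * (L (n - k) / S)) = real_of_int (\<Sum>k\<in>{1..<n}. L k * L (n - k)) / S\<^sup>2"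
      by (simp add: sum_divide_distrib power2_eq_square)
    hence eqs: "(2 ^ e * (\<Sum>k\<in>{1..<n}. (L k / S) * (L (n - k) / S)) - b / S\<^sup>2) * S\<^sup>2 = real_of_int (2 ^ e * (\<Sum>k\<in>{1..<n}. L k * L (n - k)) - b)"
      "real_of_int (L n) / S * (real n - 1) ^ Suc e * S\<^sup>2 = real_of_int (L n * S * (int n - 1) ^ Suc e)"
      using S by (simp add: left_diff_distrib, simp add: power2_eq_square mult_ac)
    with LE have "real_of_int (L n) / S * (real n - 1) ^ Suc e * S\<^sup>2 \<le> (2 ^ e * (\<Sum>k\<in>{1..<n}. (L k / S) * (L (n - k) / S)) - b / S\<^sup>2) * S\<^sup>2"
      unfolding eqs by simp
    hence "real_of_int (L n) / S * (real n - 1) ^ Suc e \<le> 2 ^ e * (\<Sum>k\<in>{1..<n}. (L k / S) * (L (n - k) / S)) - b / S\<^sup>2"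
      by (rule mult_right_le_imp_le) (use S in simp)
    also have "\<dots> \<le> 2 ^ e * (\<Sum>k\<in>{1..<n}. class_moment e k * class_moment e (n - k))
      - (if even n then (2 ^ e - 1) * class_moment (2 * e + 1) (n div 2) else 0)"
    proof (intro diff_mono mult_left_mono sum_mono mult_mono)
      show "(if even n then (2 ^ e - 1) * class_moment (2 * e + 1) (n div 2) else 0) \<le> b / S\<^sup>2"
      proof (cases "even n")
        case True
        have "(2 ^ e - 1) * class_moment (2 * e + 1) (n div 2) \<le> (2 ^ e - 1) * (U (n div 2) / S)"
          using True n less.prems by (intro mult_left_mono U) auto
        thus ?thesis using True S by (simp add: b_def power2_eq_square)
      qed (simp add: b_def)
      fix k assume k: "k \<in> {1..<n}"
      hence "n - k \<in> set [1..<Suc N]" using less.prems by auto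
      hence "0 \<le> L (n - k)" using assms(2) by blast
      thus "0 \<le> real_of_int (L (n - k)) / real_of_int S"
        using S by simp
    qed (use less assms(1,2,3) S in \<open>auto simp: class_moment_nonneg\<close>)
    also have "\<dots> = class_moment e n * (real n - 1) ^ Suc e"
      by (rule class_moment_rec[OF n, symmetric])
    finally show ?thesis
      by (rule mult_right_le_imp_le) (use n in auto)
  qed
qed

lemma class_moment_upper:
  fixes L U :: "nat \<Rightarrow> int" and S :: int
  assumes "S > 0" "U 1 \<ge> S"
    and L: "\<And>n. n \<ge> 1 \<Longrightarrow> 2 * n \<le> N \<Longrightarrow> L n / S \<le> class_moment (2 * e + 1) n"
    and check: "\<forall>n\<in>set [2..<Suc N]. U n * S * (int n - 1) ^ Suc e \<ge>
      2 ^ e * (\<Sum>k\<leftarrow>[1..<n]. U k * U (n - k)) - (if even n then (2 ^ e - 1) * (S * L (n div 2)) else 0)"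
    and "n \<ge> 1" "n \<le> N"
  shows "class_moment e n \<le> U n / S"
  using assms(5,6)
proof (induction n rule: less_induct)
  case (less n)
  have S: "real_of_int S > 0" using \<open>S > 0\<close> by simp
  show ?case
  proof (cases "n = 1")
    case True
    thus ?thesis using assms S by (simp add: class_moment_single)
  next
    case False
    with less.prems have n: "n \<ge> 2" by simp
    have n': "n \<in> set [2..<Suc N]" using n less.prems by auto
    define b where "b = (if even n then (2 ^ e - 1) * (S * L (n div 2)) else 0)"
    have LE: "real_of_int (U n * S * (int n - 1) ^ Suc e) \<ge> real_of_int (2 ^ e * (\<Sum>k\<in>{1..<n}. U k * U (n - k)) - b)"
      using bspec[OF check n'] unfolding b_def sum_list_upt by (intro of_int_le_iff[THEN iffD2])
    have "(\<Sum>k\<in>{1..<n}. (U k / S) * (U (n - k) / S)) = real_of_int (\<Sum>k\<in>{1..<n}. U k * U (n - k)) / S\<^sup>2"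
      by (simp add: sum_divide_distrib power2_eq_square)
    hence eqs: "(2 ^ e * (\<Sum>k\<in>{1..<n}. (U k / S) * (U (n - k) / S)) - b / S\<^sup>2) * S\<^sup>2 = real_of_int (2 ^ e * (\<Sum>k\<in>{1..<n}. U k * U (n - k)) - b)"
      "real_of_int (U n) / S * (real n - 1) ^ Suc e * S\<^sup>2 = real_of_int (U n * S * (int n - 1) ^ Suc e)"
      using S by (simp add: left_diff_distrib, simp add: power2_eq_square mult_ac)
    with LE have "(2 ^ e * (\<Sum>k\<in>{1..<n}. (U k / S) * (U (n - k) / S)) - b / S\<^sup>2) * S\<^sup>2 \<le> real_of_int (U n) / S * (real n - 1) ^ Suc e * S\<^sup>2"
      unfolding eqs by simp
    hence main: "2 ^ e * (\<Sum>k\<in>{1..<n}. (U k / S) * (U (n - k) / S)) - b / S\<^sup>2 \<le> real_of_int (U n) / S * (real n - 1) ^ Suc e"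
      by (rule mult_right_le_imp_le) (use S in simp)
    have "class_moment e n * (real n - 1) ^ Suc e = 2 ^ e * (\<Sum>k\<in>{1..<n}. class_moment e k * class_moment e (n - k))
      - (if even n then (2 ^ e - 1) * class_moment (2 * e + 1) (n div 2) else 0)"
      by (rule class_moment_rec[OF n])
    also have "\<dots> \<le> 2 ^ e * (\<Sum>k\<in>{1..<n}. (U k / S) * (U (n - k) / S)) - b / S\<^sup>2"
    proof (intro diff_mono mult_left_mono sum_mono mult_mono)
      show "b / S\<^sup>2 \<le> (if even n then (2 ^ e - 1) * class_moment (2 * e + 1) (n div 2) else 0)"
      proof (cases "even n")
        case True
        have "(2 ^ e - 1) * (L (n div 2) / S) \<le> (2 ^ e - 1) * class_moment (2 * e + 1) (n div 2)"
          using True n less.prems by (intro mult_left_mono L) auto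
        thus ?thesis using True S by (simp add: b_def power2_eq_square)
      qed (simp add: b_def)
      fix k assume k: "k \<in> {1..<n}"
      show "0 \<le> real_of_int (U k) / S"
        using less.IH[of k] k less.prems class_moment_nonneg[of e k] by auto
    qed (use less assms(1,2,3) S in \<open>auto simp: class_moment_nonneg\<close>)
    also note main
    finally show ?thesis
      by (rule mult_right_le_imp_le) (use n in auto)
  qed
qed

text \<open>The moments in units of \<open>10\<^bsup>-14\<^esup>\<close>, as computed from \<open>class_moment_rec\<close> with directed rounding; the
  entry \<open>0\<close> is a dummy. A lower bound for order \<open>e\<close> requires an upper bound for order \<open>2 e + 1\<close> at half
  the size and conversely.\<close>

definition moment_15_upper :: "nat \<Rightarrow> int" where
  "moment_15_upper n = [0, 100000000000000, 100000000000000, 100000000000000] ! n"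

definition moment_7_lower :: "nat \<Rightarrow> int" where
  "moment_7_lower n = [0, 100000000000000, 100000000000000, 100000000000000, 3917085810089,
    405926116445, 3089129096] ! n"

definition moment_3_upper :: "nat \<Rightarrow> int" where
  "moment_3_upper n = [0, 100000000000000, 100000000000000, 100000000000000, 20987654320988,
    7561728395062, 890864197531, 363459838440, 62005734668, 11341246824, 1785299373, 350045931,
    61843523, 9648218] ! n"

definition moment_1_lower :: "nat \<Rightarrow> int" where
  "moment_1_lower n = [0, 100000000000000, 100000000000000, 100000000000000, 55555555555555,
    38888888888888, 19111111111110, 12617283950617, 6596119929453, 3745590828924,
    1938151849674, 1068862542730, 559579987428, 295109418861, 152014858056, 79639137014,
    40859496752, 21093045345, 10764945179, 5508389130, 2798947589, 1422220419, 719464315,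
    363813613, 183366117, 92345047, 46394831] ! n"

text \<open>There is only one class for each of the sizes 1, 2 and 3, so the chain of orders 1, 3,
  7, 15 with size ranges 26, 13, 6, 3 can end here.\<close>

lemma class_moment_15_le:
  assumes "n \<ge> 1" "n \<le> 3"
  shows "class_moment 15 n \<le> real_of_int (moment_15_upper n) / real_of_int 100000000000000"
proof (rule class_moment_upper[where N = 3 and L = "\<lambda>_. 100000000000000"])
  fix n :: nat assume "n \<ge> 1" "2 * n \<le> 3"
  hence "n = 1" by simp
  thus "real_of_int 100000000000000 / real_of_int 100000000000000 \<le> class_moment (2 * 15 + 1) n"
    by (simp add: class_moment_single)
qed (rule assms | code_simp)+

lemma class_moment_7_ge:
  assumes "n \<ge> 1" "n \<le> 6"
  shows "real_of_int (moment_7_lower n) / real_of_int 100000000000000 \<le> class_moment 7 n"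
proof (rule class_moment_lower[where N = 6 and U = "moment_15_upper"])
  fix n :: nat assume "n \<ge> 1" "2 * n \<le> 6"
  thus "class_moment (2 * 7 + 1) n \<le> real_of_int (moment_15_upper n) / real_of_int 100000000000000"
    using class_moment_15_le[of n] by simp
qed (rule assms | code_simp)+

lemma class_moment_3_le:
  assumes "n \<ge> 1" "n \<le> 13"
  shows "class_moment 3 n \<le> real_of_int (moment_3_upper n) / real_of_int 100000000000000"
proof (rule class_moment_upper[where N = 13 and L = "moment_7_lower"])
  fix n :: nat assume "n \<ge> 1" "2 * n \<le> 13"
  thus "real_of_int (moment_7_lower n) / real_of_int 100000000000000 \<le> class_moment (2 * 3 + 1) n"
    using class_moment_7_ge[of n] by simp
qed (rule assms | code_simp)+

lemma class_moment_1_ge: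
  assumes "n \<ge> 1" "n \<le> 26"
  shows "real_of_int (moment_1_lower n) / real_of_int 100000000000000 \<le> class_moment 1 n"
proof (rule class_moment_lower[where N = 26 and U = "moment_3_upper"])
  fix n :: nat assume "n \<ge> 1" "2 * n \<le> 26"
  thus "class_moment (2 * 1 + 1) n \<le> real_of_int (moment_3_upper n) / real_of_int 100000000000000"
    using class_moment_3_le[of n] by simp
qed (rule assms | code_simp)+

text \<open>This is the part of the series with \<open>s k\<close> that comes from even sizes up to
  52. Integer division rounds every term down.\<close>

lemma symmetric_density_ge:
  "(\<Sum>j\<in>{1..26}. 2 * bst_avg (2 * j) (\<lambda>t. of_bool (symmetric_root t)) / (2 * real j * (2 * real j + 1)))
     \<ge> 0.37954934726095"
proof -
  define d :: "nat \<Rightarrow> int" where "d = (\<lambda>j. 2 * int j * (2 * int j + 1) * (2 * int j - 1))"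
  have "(37954934726095 :: int) \<le> (\<Sum>j\<leftarrow>[1..<27]. (2 * moment_1_lower j) div (2 * int j * (2 * int j + 1) * (2 * int j - 1)))"
    by code_simp
  hence "(37954934726095 :: int) \<le> (\<Sum>j\<in>{1..<27}. (2 * moment_1_lower j) div d j)"
    unfolding sum_list_upt d_def .
  also have "{1..<27} = {1..26::nat}" by auto
  finally have "real_of_int 37954934726095 \<le> real_of_int (\<Sum>j\<in>{1..26}. (2 * moment_1_lower j) div d j)"
    by (intro of_int_le_iff[THEN iffD2])
  also have "\<dots> \<le> (\<Sum>j\<in>{1..26}. real_of_int (2 * moment_1_lower j) / real_of_int (d j))"
    unfolding of_int_sum by (intro sum_mono real_of_int_div4)
  also have "\<dots> \<le> (\<Sum>j\<in>{1..26}. 100000000000000 *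
      (2 * bst_avg (2 * j) (\<lambda>t. of_bool (symmetric_root t)) / (2 * real j * (2 * real j + 1))))"
  proof (rule sum_mono)
    fix j :: nat assume j: "j \<in> {1..26}"
    have pos: "real_of_int (d j) > 0" using j by (simp add: d_def)
    have "real_of_int (2 * moment_1_lower j) \<le> 2 * (100000000000000 * class_moment 1 j)"
      using class_moment_1_ge[of j] j by simp
    hence "real_of_int (2 * moment_1_lower j) / real_of_int (d j) \<le> 2 * (100000000000000 * class_moment 1 j) / real_of_int (d j)"
      using pos by (intro divide_right_mono) auto
    also have "\<dots> = 100000000000000 * (2 * bst_avg (2 * j) (\<lambda>t. of_bool (symmetric_root t)) / (2 * real j * (2 * real j + 1)))"
      using j by (subst bst_avg_symmetric_root) (auto simp: d_def mult_ac)
    finally show "real_of_int (2 * moment_1_lower j) / real_of_int (d j) \<le>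
        100000000000000 * (2 * bst_avg (2 * j) (\<lambda>t. of_bool (symmetric_root t)) / (2 * real j * (2 * real j + 1)))" .
  qed
  finally show ?thesis
    unfolding sum_distrib_left[symmetric] by simp
qed

section \<open>The logarithmic part of the entropy rate\<close>

definition ln_step :: "nat \<Rightarrow> real" where
  "ln_step m = ln (real m) - ln (real m - 1)"

text \<open>Uses \<open>1 / (k * (k + 1)) = 1 / k - 1 / (k + 1)\<close>. The logarithms are replaced
  by increments, which are power series in \<open>1 / m\<close> and thus accessible to rational
  estimates.\<close>

lemma sum_ln_by_parts:
  assumes "K \<ge> 2"
  shows "(\<Sum>k\<in>{2..K}. ln (real k - 1) / (real k * (real k + 1))) =
    (\<Sum>m\<in>{2..<K}. ln_step m / (real m + 1)) - ln (real K - 1) / (real K + 1)"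
  using assms
proof (induction K rule: dec_induct)
  case (step K)
  have "ln (real K) / ((real K + 1) * (real K + 2)) = ln (real K) / (real K + 1) - ln (real K) / (real K + 2)"
    by (simp add: divide_simps) (simp add: algebra_simps)
  thus ?case
    using step by (simp add: ln_step_def diff_divide_distrib add.commute)
qed simp

lemma ln_step_eq: "m \<ge> 2 \<Longrightarrow> ln_step m = ln (real m / (real m - 1))"
  by (simp add: ln_step_def ln_div)

text \<open>Rests on \<open>ln (m / (m - 1)) = 2 * artanh (1 / (2 * m - 1))\<close>: the first
  thirteen terms of this positive series are summed with integer division rounding down.\<close>

lemma ln_step_head:
  "(\<Sum>m\<in>{2..<32}. ln_step m / (real m + 1)) \<ge> 0.570282241353204"
proof -
  have "(570282241353204 :: int) \<le> (\<Sum>m\<leftarrow>[2..<32]. \<Sum>k\<leftarrow>[0..<13].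
     2 * 10 ^ 15 div ((2 * int k + 1) * (2 * int m - 1) ^ (2 * k + 1) * (int m + 1)))"
    by code_simp
  hence "real_of_int 570282241353204 \<le> real_of_int (\<Sum>m\<in>{2..<32}. \<Sum>k\<in>{0..<13}.
     2 * 10 ^ 15 div ((2 * int k + 1) * (2 * int m - 1) ^ (2 * k + 1) * (int m + 1)))"
    unfolding sum_list_upt by (intro of_int_le_iff[THEN iffD2])
  also have "\<dots> \<le> (\<Sum>m\<in>{2..<32}. \<Sum>k\<in>{0..<13}. real_of_int (2 * 10 ^ 15)
      / real_of_int ((2 * int k + 1) * (2 * int m - 1) ^ (2 * k + 1) * (int m + 1)))"
    unfolding of_int_sum by (intro sum_mono real_of_int_div4)
  also have "\<dots> \<le> (\<Sum>m\<in>{2..<32}. 10 ^ 15 * (ln_step m / (real m + 1)))"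
  proof (rule sum_mono)
    fix m :: nat assume m: "m \<in> {2..<32}"
    define x where "x = real m / (real m - 1)"
    have x: "x > 1" "(x - 1) / (x + 1) = 1 / (2 * real m - 1)"
      using m by (simp_all add: x_def divide_simps)
    have "(\<Sum>k<13. 2 * (1 / (2 * real m - 1)) ^ (2 * k + 1) / real (2 * k + 1)) \<le> ln_step m"
      using ln_approx_bounds[OF x(1), of 13] m unfolding x(2) by (simp add: ln_step_eq x_def)
    hence "10 ^ 15 * ((\<Sum>k<13. 2 * (1 / (2 * real m - 1)) ^ (2 * k + 1) / real (2 * k + 1)) / (real m + 1))
            \<le> 10 ^ 15 * (ln_step m / (real m + 1))"
      by (intro mult_left_mono divide_right_mono) auto
    also have "10 ^ 15 * ((\<Sum>k<13. 2 * (1 / (2 * real m - 1)) ^ (2 * k + 1) / real (2 * k + 1)) / (real m + 1)) =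
      (\<Sum>k\<in>{0..<13}. real_of_int (2 * 10 ^ 15) / real_of_int ((2 * int k + 1) * (2 * int m - 1) ^ (2 * k + 1) * (int m + 1)))"
      unfolding sum_divide_distrib sum_distrib_left lessThan_atLeast0
      by (intro sum.cong refl) (simp add: power_divide mult_ac)
    finally show "(\<Sum>k\<in>{0..<13}. real_of_int (2 * 10 ^ 15)
        / real_of_int ((2 * int k + 1) * (2 * int m - 1) ^ (2 * k + 1) * (int m + 1))) \<le> 10 ^ 15 * (ln_step m / (real m + 1))" .
  qed
  finally show ?thesis
    unfolding sum_distrib_left[symmetric] by simp
qed

text \<open>The asymptotic expansion, in \<open>x = 1 / m\<close>, of the tail \<open>\<Sum>k\<ge>m. ln (k / (k - 1)) / (k + 1)\<close>, truncated
  where the error at \<open>m = 32\<close> drops below the required precision. It is a lower bound because the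
  polynomial in \<open>ln_tail_identity\<close> has only positive coefficients.\<close>

definition ln_tail :: "real \<Rightarrow> real" where
  "ln_tail x = x + x ^ 2 / 4 + 7 / 36 * x ^ 3 + 7 / 48 * x ^ 4 + 197 / 1800 * x ^ 5 + 7 / 80 * x ^ 6"

text \<open>For \<open>x = 1 / m\<close>, \<open>x / (1 + x)\<close> is \<open>1 / (m + 1)\<close>.
  The six coefficients of \<open>ln_tail\<close> are those that cancel the powers
  \<open>x ^ 2\<close> to \<open>x ^ 7\<close>.\<close>

lemma ln_tail_identity:
  fixes x :: real
  assumes "x > 0"
  shows "(\<Sum>i<8. x ^ Suc i / Suc i) * x / (1 + x) - (ln_tail x - ln_tail (x / (1 + x))) =
    x ^ 8 * (677 / 1260 + 4103 / 2520 * x + 1499 / 525 * x ^ 2 + 4847 / 1575 * x ^ 3 + 3433 / 1680 * x ^ 4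
      + 43 / 56 * x ^ 5 + 1 / 8 * x ^ 6) / (1 + x) ^ 6"
proof -
  define y where "y = 1 + x"
  have y: "y \<noteq> 0" "x = y - 1" using assms by (auto simp: y_def)
  have "((\<Sum>i<8. x ^ Suc i / Suc i) * x / y - (ln_tail x - ln_tail (x / y))) * y ^ 6 =
    (\<Sum>i<8. x ^ Suc i / Suc i) * x * y ^ 5 - ln_tail x * y ^ 6 
    + (x * y ^ 5 + x ^ 2 * y ^ 4 / 4 + 7 / 36 * x ^ 3 * y ^ 3 + 7 / 48 * x ^ 4 * y ^ 2 + 197 / 1800 * x ^ 5 * y + 7 / 80 * x ^ 6)"
    using y(1) by (simp add: ln_tail_def[of "x / y"] power_divide divide_simps) (simp add: algebra_simps eval_nat_numeral)?
  also have "\<dots> = x ^ 8 * (677 / 1260 + 4103 / 2520 * x + 1499 / 525 * x ^ 2 + 4847 / 1575 * x ^ 3 + 3433 / 1680 * x ^ 4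
      + 43 / 56 * x ^ 5 + 1 / 8 * x ^ 6)"
    unfolding y_def ln_tail_def by (simp add: eval_nat_numeral) (simp add: field_simps)?
  finally show ?thesis
    using y(1) by (simp add: y_def[symmetric] eq_divide_eq)
qed

lemma ln_step_ge_tail:
  assumes "m \<ge> 2"
  shows "ln_tail (1 / real m) - ln_tail (1 / real (Suc m)) \<le> ln_step m / (real m + 1)"
proof -
  define x where "x = 1 / real m"
  have x: "0 < x" "x < 1" using assms by (auto simp: x_def)
  have series: "(\<lambda>n. x ^ n / real n) sums (- ln (1 - x))"
    using sums_minus[OF ln_series'[of "- x"]] x by simp
  \<comment> \<open>The added term for \<open>n = 0\<close> is \<open>1 / 0 = 0\<close>.\<close>
  have "(\<Sum>i<8. x ^ Suc i / Suc i) = (\<Sum>n<9. x ^ n / real n)"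
    by (simp add: eval_nat_numeral)
  also have "\<dots> \<le> - ln (1 - x)"
    using series x by (subst sums_unique[OF series]) (intro sum_le_suminf, auto simp: sums_iff)
  also have "- ln (1 - x) = ln_step m"
    using assms x ln_div[of "real m - 1" "real m"] by (simp add: ln_step_def x_def diff_divide_distrib)
  finally have "(\<Sum>i<8. x ^ Suc i / Suc i) * x / (1 + x) \<le> ln_step m * x / (1 + x)"
    using x by (intro divide_right_mono mult_right_mono) auto
  also have "\<dots> = ln_step m / (real m + 1)"
    using assms by (simp add: x_def divide_simps)
  finally have "(\<Sum>i<8. x ^ Suc i / Suc i) * x / (1 + x) \<le> ln_step m / (real m + 1)" .
  moreover have "0 \<le> (\<Sum>i<8. x ^ Suc i / Suc i) * x / (1 + x) - (ln_tail x - ln_tail (x / (1 + x)))"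
    unfolding ln_tail_identity[OF x(1)] using x(1)
    by (intro divide_nonneg_nonneg mult_nonneg_nonneg add_nonneg_nonneg) auto
  moreover have "x / (1 + x) = 1 / real (Suc m)"
    using assms by (simp add: x_def divide_simps)
  ultimately show ?thesis
    by (simp add: x_def)
qed

text \<open>An upper bound is the right direction: the total coefficient of \<open>ln 2\<close> in
  the entropy estimate is \<open>0.37954934726095 - 1 < 0\<close>.\<close>

lemma ln_2_upper: "ln (2 :: real) \<le> 0.69314718056"
  using ln_approx_bounds[of 2 14] by (simp add: lessThan_nat_numeral power_divide)

text \<open>\<open>K \<ge> 52\<close> brings in all sizes of \<open>symmetric_density_ge\<close>;
  the omitted symmetric terms are nonnegative. The logarithmic sum is cut at 32 into head and
  telescoping tail, and the last line vanishes as \<open>K\<close> grows.\<close>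

lemma fringe_density_entropy_toll_ge:
  assumes "K \<ge> 52"
  shows "fringe_density K (entropy_toll K) \<ge>
    2 * 0.570282241353204 + 2 * ln_tail (1 / 32) + ln 2 * 0.37954934726095
      - 2 * (ln_tail (1 / real K) + ln (real K - 1) / (real K + 1))"
proof -
  define s where "s = (\<lambda>k. bst_avg k (\<lambda>t. of_bool (symmetric_root t)))"
  have s_nonneg: "s k \<ge> 0" for k unfolding s_def by (intro bst_avg_nonneg) auto
  have toll: "bst_avg k (entropy_toll K) = ln (real k - 1) + ln 2 * s k" if "k \<in> {2..K}" for k
  proof -
    have "bst_avg k (entropy_toll K) = bst_avg k (\<lambda>t. ln (real k - 1) + ln 2 * of_bool (symmetric_root t))"
      using that by (intro bst_avg_cong) (simp add: entropy_toll_def)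
    thus ?thesis using that by (simp add: bst_avg_add bst_avg_cmult bst_avg_const s_def)
  qed
  have "fringe_density K (entropy_toll K) = 2 * (\<Sum>k\<in>{2..K}. bst_avg k (entropy_toll K) / (real k * (real k + 1)))"
  proof -
    have "{1..K} = insert 1 {2..K}" using assms by auto
    moreover have "bst_avg 1 (entropy_toll K) = 0" by (simp add: bst_avg_1 entropy_toll_def)
    ultimately show ?thesis unfolding fringe_density_def by simp
  qed
  also have "(\<Sum>k\<in>{2..K}. bst_avg k (entropy_toll K) / (real k * (real k + 1))) =
      (\<Sum>k\<in>{2..K}. ln (real k - 1) / (real k * (real k + 1))) + ln 2 * (\<Sum>k\<in>{2..K}. s k / (real k * (real k + 1)))"
    unfolding sum_distrib_left sum.distrib[symmetric]
    by (intro sum.cong refl) (simp add: toll add_divide_distrib)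
  finally have eq: "fringe_density K (entropy_toll K) = 2 * (\<Sum>k\<in>{2..K}. ln (real k - 1) / (real k * (real k + 1)))
      + ln 2 * (2 * (\<Sum>k\<in>{2..K}. s k / (real k * (real k + 1))))"
    by (simp add: algebra_simps)
  have "0.37954934726095 \<le> (\<Sum>j\<in>{1..26}. 2 * s (2 * j) / (2 * real j * (2 * real j + 1)))"
    using symmetric_density_ge by (simp add: s_def)
  also have "\<dots> = (\<Sum>k\<in>(\<lambda>j. 2 * j) ` {1..26}. 2 * s k / (real k * (real k + 1)))"
    by (subst sum.reindex) (auto simp: inj_on_def)
  also have "\<dots> \<le> (\<Sum>k\<in>{2..K}. 2 * s k / (real k * (real k + 1)))"
    using assms s_nonneg by (intro sum_mono2) auto
  also have "\<dots> = 2 * (\<Sum>k\<in>{2..K}. s k / (real k * (real k + 1)))"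
    by (simp add: sum_distrib_left)
  finally have sym: "ln 2 * 0.37954934726095 \<le> ln 2 * (2 * (\<Sum>k\<in>{2..K}. s k / (real k * (real k + 1))))"
    by (intro mult_left_mono) auto
  have "0.570282241353204 + (ln_tail (1 / 32) - ln_tail (1 / real K))
     \<le> (\<Sum>m\<in>{2..<32}. ln_step m / (real m + 1)) + (\<Sum>m\<in>{32..<K}. ln_step m / (real m + 1))"
  proof (rule add_mono[OF ln_step_head])
    have "ln_tail (1 / 32) - ln_tail (1 / real K) = (\<Sum>m\<in>{32..<K}. ln_tail (1 / real m) - ln_tail (1 / real (Suc m)))"
      using assms sum_Suc_diff'[of 32 K "\<lambda>m. - ln_tail (1 / real m)"] by simp
    also have "\<dots> \<le> (\<Sum>m\<in>{32..<K}. ln_step m / (real m + 1))"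
      by (intro sum_mono ln_step_ge_tail) auto
    finally show "ln_tail (1 / 32) - ln_tail (1 / real K) \<le> (\<Sum>m\<in>{32..<K}. ln_step m / (real m + 1))" .
  qed
  also have "\<dots> = (\<Sum>m\<in>{2..<K}. ln_step m / (real m + 1))"
    using assms by (intro sum.atLeastLessThan_concat) auto
  also have "\<dots> = (\<Sum>k\<in>{2..K}. ln (real k - 1) / (real k * (real k + 1))) + ln (real K - 1) / (real K + 1)"
    using assms by (simp add: sum_ln_by_parts)
  finally have head: "0.570282241353204 + (ln_tail (1 / 32) - ln_tail (1 / real K)) \<le> \<dots>" .
  have "2 * a + 2 * b + l - 2 * (c + d) \<le> 2 * S + T" if "a + (b - c) \<le> S + d" "l \<le> T" for a b c d l S T :: real
    using that by (simp add: algebra_simps)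
  from this[OF head sym] show ?thesis
    unfolding eq .
qed

lemma entropy_rate_exceeds: "\<exists>K. fringe_density K (entropy_toll K) - ln 2 > 0.7735012961025"
proof -
  have "((\<lambda>K. ln_tail (1 / real K) + ln (real K - 1) / (real K + 1)) \<longlongrightarrow> 0) sequentially"
    unfolding ln_tail_def by real_asymp
  hence "\<forall>\<^sub>F K in sequentially. ln_tail (1 / real K) + ln (real K - 1) / (real K + 1) < 1 / 10 ^ 12"
    by (rule order_tendstoD) simp
  hence "\<forall>\<^sub>F K in sequentially. fringe_density K (entropy_toll K) - ln 2 > 0.7735012961025"
    using eventually_ge_at_top[of 52]
  proof eventually_elim
    case (elim K)
    have "ln_tail (1 / 32) \<ge> 0.031500217019218"
      by (simp add: ln_tail_def power_divide)
    thus ?case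
      using fringe_density_entropy_toll_ge[OF elim(2)] elim(1) ln_2_upper by simp
  qed
  thus ?thesis
    by (rule eventually_happens'[OF sequentially_bot])
qed

section \<open>Bounds for the number of classes\<close>

lemma fringe_sum_of_bool: "fringe_sum (\<lambda>s. of_bool (Q s)) t = real (size (filter_mset Q (fringe t)))"
  by (induction t) auto

definition large_count :: "nat \<Rightarrow> btree \<Rightarrow> real" where
  "large_count K = fringe_sum (\<lambda>s. of_bool (size1 s > K))"

text \<open>Passing to the complement within all \<open>2 * n - 1\<close> fringe subtrees gives a
  toll that vanishes above \<open>K\<close>, as \<open>bst_variance\<close> requires.\<close>

lemma large_count_eq:
  "large_count K t = 2 * real (size1 t) - 1 - fringe_sum (\<lambda>s. of_bool (size1 s \<le> K)) t"
proof -
  have "large_count K t + fringe_sum (\<lambda>s. of_bool (size1 s \<le> K)) t = fringe_sum (\<lambda>_. 1) t"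
    unfolding large_count_def fringe_sum_add[symmetric] by (intro fringe_sum_cong) auto
  thus ?thesis by (simp add: fringe_sum_const)
qed

lemma fringe_density_small:
  "fringe_density K (\<lambda>s. of_bool (size1 s \<le> K)) = 2 - 2 / real (Suc K)"
proof -
  have "bst_avg k (\<lambda>s. of_bool (size1 s \<le> K)) = 1" if "k \<in> {1..K}" for k
  proof -
    have "bst_avg k (\<lambda>s. of_bool (size1 s \<le> K)) = bst_avg k (\<lambda>_. 1)"
      using that by (intro bst_avg_cong) auto
    thus ?thesis using that by (simp add: bst_avg_const)
  qed
  hence "fringe_density K (\<lambda>s. of_bool (size1 s \<le> K)) = 2 * (\<Sum>k\<in>{1..<Suc K}. 1 / (real k * (real k + 1)))"
    unfolding fringe_density_def atLeastLessThanSuc_atLeastAtMost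
    by (intro arg_cong2[where f = "(*)"] sum.cong refl) auto
  also have "\<dots> = 2 - 2 / real (Suc K)"
    by (subst sum_inverse_product_telescope) auto
  finally show ?thesis .
qed

lemma large_count_mean:
  assumes "n > K"
  shows "bst_avg n (large_count K) = 2 * real n / real (Suc K) - 1"
proof -
  have "bst_avg n (large_count K) = bst_avg n (\<lambda>t. 2 * real n - 1 - fringe_sum (\<lambda>s. of_bool (size1 s \<le> K)) t)"
    by (intro bst_avg_cong) (simp add: large_count_eq)
  also have "\<dots> = 2 * real n - 1 - (2 - 2 / real (Suc K)) * real n"
    unfolding bst_avg_diff fringe_density_small[symmetric] using assms
    by (subst bst_avg_fringe_sum_truncated[where K = K]) (auto simp: bst_avg_const)
  finally show ?thesis by (simp add: algebra_simps)
qed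

lemma large_count_variance:
  assumes "n > K"
  shows "bst_avg n (\<lambda>t. (large_count K t - (2 * real n / real (Suc K) - 1))\<^sup>2) \<le> 16 * (real K)\<^sup>2 * real n"
proof -
  have "bst_avg n (\<lambda>t. (large_count K t - (2 * real n / real (Suc K) - 1))\<^sup>2) =
        bst_avg n (\<lambda>t. (fringe_sum (\<lambda>s. of_bool (size1 s \<le> K)) t
                - fringe_density K (\<lambda>s. of_bool (size1 s \<le> K)) * real n)\<^sup>2)"
  proof (rule bst_avg_cong)
    fix t :: btree assume t: "size1 t = n"
    have "large_count K t - (2 * real n / real (Suc K) - 1) =
          - (fringe_sum (\<lambda>s. of_bool (size1 s \<le> K)) t - fringe_density K (\<lambda>s. of_bool (size1 s \<le> K)) * real n)"
      unfolding large_count_eq fringe_density_small t by (simp add: algebra_simps del: of_nat_Suc)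
    thus "(large_count K t - (2 * real n / real (Suc K) - 1))\<^sup>2 =
          (fringe_sum (\<lambda>s. of_bool (size1 s \<le> K)) t - fringe_density K (\<lambda>s. of_bool (size1 s \<le> K)) * real n)\<^sup>2"
      by (simp only: power2_minus)
  qed
  also have "\<dots> \<le> (4 * real K * 1)\<^sup>2 * real n"
    using assms by (intro bst_variance) auto
  finally show ?thesis by (simp add: power_mult_distrib)
qed

lemma num_noniso_fringe_le:
  "real (num_noniso_fringe t) \<le> real (card (unordered_upto K)) + large_count K t"
proof -
  have "unordered ` subtrees t \<subseteq> unordered_upto K \<union> unordered ` set_mset (filter_mset (\<lambda>s. size1 s > K) (fringe t))"
  proof
    fix u assume "u \<in> unordered ` subtrees t"
    then obtain s where "s \<in> subtrees t" "u = unordered s" by auto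
    thus "u \<in> unordered_upto K \<union> unordered ` set_mset (filter_mset (\<lambda>s. size1 s > K) (fringe t))"
      by (cases "size1 s > K") (auto simp: unordered_upto_def set_mset_fringe not_less)
  qed
  hence "card (unordered ` subtrees t) \<le> card (unordered_upto K \<union> unordered ` set_mset (filter_mset (\<lambda>s. size1 s > K) (fringe t)))"
    by (intro card_mono finite_UnI finite_unordered_upto finite_imageI) auto
  also have "\<dots> \<le> card (unordered_upto K) + card (unordered ` set_mset (filter_mset (\<lambda>s. size1 s > K) (fringe t)))"
    by (rule card_Un_le)
  also have "card (unordered ` set_mset (filter_mset (\<lambda>s. size1 s > K) (fringe t)))
      \<le> card (set_mset (filter_mset (\<lambda>s. size1 s > K) (fringe t)))"
    by (intro card_image_le) auto
  also have "\<dots> \<le> size (filter_mset (\<lambda>s. size1 s > K) (fringe t))"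
    unfolding size_multiset_overloaded_eq
    by (rule order.trans[OF _ sum_mono[where f = "\<lambda>_. 1"]]) (auto simp: Suc_le_eq)
  finally show ?thesis
    unfolding num_noniso_fringe_altdef large_count_def fringe_sum_of_bool by linarith
qed

definition atypical_count :: "real \<Rightarrow> nat \<Rightarrow> btree \<Rightarrow> real" where
  "atypical_count \<theta> K = fringe_sum (\<lambda>s. of_bool (size1 s > K \<and> atypical \<theta> s))"

definition typical_classes :: "real \<Rightarrow> nat \<Rightarrow> nat \<Rightarrow> utree set" where
  "typical_classes \<theta> K n = unordered ` {s :: btree. K < size1 s \<and> size1 s \<le> n \<and> \<not> atypical \<theta> s}"

definition class_count :: "utree \<Rightarrow> btree \<Rightarrow> real" where
  "class_count u = fringe_sum (\<lambda>s. of_bool (unordered s = u))"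

text \<open>The number of ordered pairs of different nodes whose subtrees lie in the same typical
  class.\<close>

definition repetitions :: "real \<Rightarrow> nat \<Rightarrow> nat \<Rightarrow> btree \<Rightarrow> real" where
  "repetitions \<theta> K n t = (\<Sum>u\<in>typical_classes \<theta> K n. class_count u t * (class_count u t - 1))"

lemma finite_typical_classes: "finite (typical_classes \<theta> K n)"
  by (rule finite_subset[OF _ finite_unordered_upto[of n]]) (auto simp: typical_classes_def unordered_upto_def)

text \<open>\<open>m - m * (m - 1)\<close> is \<open>1\<close> for \<open>m = 1\<close> and at most
  \<open>0\<close> for every other natural number: subtracting pairs may overcorrect, which is
  harmless for a lower bound.\<close>

lemma class_count_le:
  "class_count u t - class_count u t * (class_count u t - 1) \<le> of_bool (u \<in> unordered ` subtrees t)"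
proof -
  define m where "m = size (filter_mset (\<lambda>s. unordered s = u) (fringe t))"
  have m: "class_count u t = real m"
    by (simp add: class_count_def fringe_sum_of_bool m_def)
  consider "m = 0" | "m = 1" | "m \<ge> 2" by linarith
  thus ?thesis
  proof cases
    case 2
    have "filter_mset (\<lambda>s. unordered s = u) (fringe t) \<noteq> {#}"
    proof
      assume "filter_mset (\<lambda>s. unordered s = u) (fringe t) = {#}"
      hence "m = 0" by (simp only: m_def) simp
      thus False using 2 by simp
    qed
    then obtain s where "s \<in># filter_mset (\<lambda>s. unordered s = u) (fringe t)"
      by (rule multiset_nonemptyE)
    hence "u \<in> unordered ` subtrees t"
      by (auto simp: set_mset_fringe[symmetric])
    thus ?thesis using 2 m by simp
  next
    case 3
    have "real m * 1 \<le> real m * (real m - 1)"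
      using 3 by (intro mult_left_mono) auto
    thus ?thesis using m by simp
  qed (use m in auto)
qed

lemma num_noniso_fringe_ge:
  assumes "size1 t \<le> n"
  shows "large_count K t - atypical_count \<theta> K t - repetitions \<theta> K n t \<le> real (num_noniso_fringe t)"
proof -
  define U where "U = typical_classes \<theta> K n"
  have fin: "finite U" by (simp add: U_def finite_typical_classes)
  \<comment> \<open>Size and typicality depend on the class alone, so any representative
    decides.\<close>
  have U_iff: "unordered s \<in> U \<longleftrightarrow> K < size1 s \<and> size1 s \<le> n \<and> \<not> atypical \<theta> s" for s :: btree
  proof
    assume "unordered s \<in> U"
    then obtain s' :: btree where s': "unordered s = unordered s'" "K < size1 s'" "size1 s' \<le> n" "\<not> atypical \<theta> s'"
      by (auto simp: U_def typical_classes_def)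
    moreover have "size1 s = size1 s'"
      using arg_cong[OF s'(1), of usize] by simp
    ultimately show "K < size1 s \<and> size1 s \<le> n \<and> \<not> atypical \<theta> s"
      by (simp add: atypical_def)
  qed (auto simp: U_def typical_classes_def)
  have "large_count K t = fringe_sum (\<lambda>s. (\<Sum>u\<in>U. of_bool (unordered s = u)) + of_bool (size1 s > K \<and> atypical \<theta> s)) t"
    unfolding large_count_def
  proof (rule fringe_sum_cong)
    fix s assume "s \<in> subtrees t"
    hence "size1 s \<le> n" using size1_subtrees_le assms by (metis le_trans)
    moreover have "(\<Sum>u\<in>U. of_bool (unordered s = u)) = (of_bool (unordered s \<in> U) :: real)"
      using fin by (simp add: of_bool_def)
    ultimately show "of_bool (K < size1 s) =
        (\<Sum>u\<in>U. of_bool (unordered s = u)) + (of_bool (size1 s > K \<and> atypical \<theta> s) :: real)"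
      by (auto simp: U_iff)
  qed
  also have "\<dots> = (\<Sum>u\<in>U. class_count u t) + atypical_count \<theta> K t"
    by (simp add: fringe_sum_add fringe_sum_sum class_count_def atypical_count_def)
  finally have "large_count K t - atypical_count \<theta> K t - repetitions \<theta> K n t =
      (\<Sum>u\<in>U. class_count u t - class_count u t * (class_count u t - 1))"
    by (simp add: repetitions_def U_def sum_subtractf)
  also have "\<dots> \<le> (\<Sum>u\<in>U. of_bool (u \<in> unordered ` subtrees t))"
    by (intro sum_mono class_count_le)
  also have "\<dots> = real (card (U \<inter> unordered ` subtrees t))"
    using fin by (simp add: of_bool_def sum.If_cases)
  also have "card (U \<inter> unordered ` subtrees t) \<le> card (unordered ` subtrees t)"
    by (intro card_mono) (auto simp flip: set_mset_fringe)
  finally show ?thesis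
    by (simp add: num_noniso_fringe_altdef)
qed

lemma sum_class_prob_le_1: "(\<Sum>u\<in>unordered ` {s :: btree. size1 s = m \<and> Q s}. class_prob u) \<le> 1"
proof (cases "m = 0")
  case True
  thus ?thesis by (simp add: size1_size)
next
  case False
  define V where "V = unordered ` {s :: btree. size1 s = m \<and> Q s}"
  have fin: "finite V"
    unfolding V_def by (intro finite_imageI finite_subset[OF _ finite_trees_size1[of m]]) auto
  have "(\<Sum>u\<in>V. class_prob u) = (\<Sum>u\<in>V. bst_avg m (\<lambda>t. of_bool (unordered t = u)))"
    by (intro sum.cong) (auto simp: V_def bst_avg_class)
  also have "\<dots> = bst_avg m (\<lambda>t. \<Sum>u\<in>V. of_bool (unordered t = u))"
    by (rule bst_avg_sum[symmetric])
  also have "\<dots> \<le> 1"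
    using False fin by (intro bst_avg_le_const) (auto simp: of_bool_def)
  finally show ?thesis by (simp add: V_def)
qed

text \<open>Among the typical classes of size \<open>m\<close>,
  \<open>p\<^sup>2 \<le> r ^ m * p\<close>, and the probabilities \<open>p\<close> sum to at most 1.
  What remains is a geometric series over \<open>m > K\<close>.\<close>

lemma sum_class_prob_square_le:
  assumes "\<theta> > 0"
  shows "(\<Sum>u\<in>typical_classes \<theta> K n. (class_prob u)\<^sup>2) \<le> exp (- (\<theta> * real K)) / (1 - exp (- \<theta>))"
proof -
  define r where "r = exp (- \<theta>)"
  have r: "0 < r" "r < 1" using assms by (auto simp: r_def)
  define T where "T = (\<lambda>m. unordered ` {s :: btree. size1 s = m \<and> \<not> atypical \<theta> s})"
  have fin: "finite (T m)" for m
    unfolding T_def by (intro finite_imageI finite_subset[OF _ finite_trees_size1[of m]]) auto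
  have "typical_classes \<theta> K n = (\<Union>m\<in>{K<..n}. T m)"
    by (auto simp: typical_classes_def T_def)
  moreover have "usize u = m" if "u \<in> T m" for u m
    using that by (auto simp: T_def)
  hence "\<forall>m\<in>{K<..n}. \<forall>m'\<in>{K<..n}. m \<noteq> m' \<longrightarrow> T m \<inter> T m' = {}"
    by blast
  ultimately have "(\<Sum>u\<in>typical_classes \<theta> K n. (class_prob u)\<^sup>2) = (\<Sum>m\<in>{K<..n}. \<Sum>u\<in>T m. (class_prob u)\<^sup>2)"
    using fin by (simp add: sum.UNION_disjoint)
  also have "\<dots> \<le> (\<Sum>m\<in>{K<..n}. r ^ m)"
  proof (rule sum_mono)
    fix m
    have "(\<Sum>u\<in>T m. (class_prob u)\<^sup>2) \<le> (\<Sum>u\<in>T m. r ^ m * class_prob u)"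
      unfolding power2_eq_square
      by (intro sum_mono mult_right_mono class_prob_nonneg)
         (auto simp: T_def atypical_def r_def not_less exp_of_nat_mult[symmetric] mult_ac)
    also have "\<dots> \<le> r ^ m * 1"
      unfolding sum_distrib_left[symmetric] T_def using r
      by (intro mult_left_mono sum_class_prob_le_1) auto
    finally show "(\<Sum>u\<in>T m. (class_prob u)\<^sup>2) \<le> r ^ m" by simp
  qed
  also have "\<dots> \<le> r ^ K / (1 - r)"
  proof -
    have "(\<Sum>m\<in>{K<..n}. r ^ m) \<le> (\<Sum>m. r ^ (m + K))"
    proof -
      have "(\<Sum>m\<in>{K<..n}. r ^ m) = (\<Sum>m\<in>(\<lambda>m. m - K) ` {K<..n}. r ^ (m + K))"
        by (subst sum.reindex) (auto simp: inj_on_def)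
      also have "\<dots> \<le> (\<Sum>m. r ^ (m + K))"
        using r by (intro sum_le_suminf) (auto simp: power_add intro!: summable_mult2 summable_geometric)
      finally show ?thesis .
    qed
    also have "\<dots> = r ^ K / (1 - r)"
      using r by (simp add: power_add suminf_mult2[symmetric] suminf_geometric summable_geometric)
    finally show ?thesis .
  qed
  also have "r ^ K = exp (- (\<theta> * real K))"
    by (simp add: r_def exp_of_nat_mult[symmetric] mult_ac)
  finally show ?thesis by (simp add: r_def)
qed

lemma repetitions_nonneg: "0 \<le> repetitions \<theta> K n t"
  unfolding repetitions_def
proof (rule sum_nonneg)
  fix u
  show "0 \<le> class_count u t * (class_count u t - 1)"
  proof -
    have "0 \<le> real m * (real m - 1)" for m :: nat by (cases m) auto
    thus ?thesis unfolding class_count_def fringe_sum_of_bool .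
  qed
qed

lemma repetitions_mean:
  assumes "\<theta> > 0" "n > 0"
  shows "bst_avg n (repetitions \<theta> K n) \<le> (real n)\<^sup>2 * (exp (- (\<theta> * real K)) / (1 - exp (- \<theta>)))"
proof -
  have "bst_avg n (repetitions \<theta> K n) = (\<Sum>u\<in>typical_classes \<theta> K n. bst_avg n (\<lambda>t. class_count u t * (class_count u t - 1)))"
    unfolding repetitions_def by (rule bst_avg_sum)
  also have "\<dots> \<le> (\<Sum>u\<in>typical_classes \<theta> K n. (class_prob u)\<^sup>2 * (real n)\<^sup>2)"
    unfolding class_count_def using assms by (intro sum_mono bst_avg_pairs)
  also have "\<dots> = (real n)\<^sup>2 * (\<Sum>u\<in>typical_classes \<theta> K n. (class_prob u)\<^sup>2)"
    by (simp add: sum_distrib_left mult_ac)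
  also have "\<dots> \<le> (real n)\<^sup>2 * (exp (- (\<theta> * real K)) / (1 - exp (- \<theta>)))"
    using assms by (intro mult_left_mono sum_class_prob_square_le) auto
  finally show ?thesis .
qed

lemma atypical_count_nonneg: "0 \<le> atypical_count \<theta> K t"
  unfolding atypical_count_def by (intro fringe_sum_nonneg) auto

text \<open>The root accounts for the \<open>1\<close>. Below it, the frequencies of the sizes above
  \<open>K\<close> telescope to less than \<open>1 / Suc K\<close>.\<close>

lemma atypical_count_mean:
  assumes rare: "\<And>k. k > K \<Longrightarrow> bst_avg k (\<lambda>t. of_bool (atypical \<theta> t)) \<le> \<epsilon>" and "\<epsilon> \<ge> 0" "n > K"
  shows "bst_avg n (atypical_count \<theta> K) \<le> 1 + 2 * real n * \<epsilon> / real (Suc K)"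
proof -
  define \<gamma> where "\<gamma> = (\<lambda>k. bst_avg k (\<lambda>s. of_bool (size1 s > K \<and> atypical \<theta> s)))"
  have \<gamma>_le: "\<gamma> k \<le> (if k > K then \<epsilon> else 0)" for k
  proof (cases "k > K")
    case True
    hence "\<gamma> k = bst_avg k (\<lambda>t. of_bool (atypical \<theta> t))"
      unfolding \<gamma>_def by (intro bst_avg_cong) auto
    thus ?thesis using rare True by simp
  next
    case False
    hence "\<gamma> k = bst_avg k (\<lambda>_. 0)"
      unfolding \<gamma>_def by (intro bst_avg_cong) auto
    thus ?thesis using False by (simp add: bst_avg_def)
  qed
  have "(\<Sum>k\<in>{1..<n}. \<gamma> k / (real k * (real k + 1))) \<le> (\<Sum>k\<in>{1..<n}. if k > K then \<epsilon> * (1 / (real k * (real k + 1))) else 0)"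
  proof (rule sum_mono)
    fix k assume "k \<in> {1..<n}"
    have "\<gamma> k / (real k * (real k + 1)) \<le> (if k > K then \<epsilon> else 0) / (real k * (real k + 1))"
      by (intro divide_right_mono \<gamma>_le) auto
    thus "\<gamma> k / (real k * (real k + 1)) \<le> (if k > K then \<epsilon> * (1 / (real k * (real k + 1))) else 0)"
      by (auto split: if_splits)
  qed
  also have "\<dots> = (\<Sum>k\<in>{Suc K..<n}. \<epsilon> * (1 / (real k * (real k + 1))))"
    by (intro sum.mono_neutral_cong_right) auto
  also have "\<dots> = \<epsilon> * (1 / real (Suc K) - 1 / real n)"
    unfolding sum_distrib_left[symmetric] using assms by (subst sum_inverse_product_telescope) auto
  also have "\<dots> \<le> \<epsilon> / real (Suc K)"
    using assms by (simp add: right_diff_distrib)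
  finally have "2 * real n * (\<Sum>k\<in>{1..<n}. \<gamma> k / (real k * (real k + 1))) \<le> 2 * real n * (\<epsilon> / real (Suc K))"
    by (intro mult_left_mono) auto
  moreover have "\<gamma> n \<le> 1"
    unfolding \<gamma>_def using assms by (intro bst_avg_le_const) auto
  moreover have "bst_avg n (atypical_count \<theta> K) = \<gamma> n + 2 * real n * (\<Sum>k\<in>{1..<n}. \<gamma> k / (real k * (real k + 1)))"
    unfolding atypical_count_def \<gamma>_def using assms by (intro bst_avg_fringe_sum) auto
  ultimately show ?thesis by simp
qed

section \<open>Asymptotics\<close>

lemma upper_bounds:
  fixes c :: real
  assumes c: "c > - 2 * ln 0.40269750365"
  shows "\<exists>K :: nat \<Rightarrow> nat. \<exists>\<beta>>0. (\<forall>\<^sub>F n in sequentially. K n < n \<and> real (K n) \<le> \<beta> * ln (real n) \<and>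
    real (card (unordered_upto (K n))) + 2 * real n / real (Suc (K n)) - 1 \<le> c * (real n / ln (real n)))"
proof -
  define a :: real where "a = - ln 0.40269750365"
  have a: "a > 0" unfolding a_def by simp
  have exp_a: "exp a = 1 / 0.40269750365" unfolding a_def by (simp add: exp_minus)
  \<comment> \<open>Makes \<open>2 / \<beta>\<close> the midpoint of \<open>2 * a\<close> and
    \<open>c\<close>: the number of small classes is at most \<open>n powr (\<beta> * a)\<close>
    with exponent below 1, and the gap \<open>c - 2 / \<beta>\<close> absorbs it.\<close>
  define \<beta> where "\<beta> = 4 / (c + 2 * a)"
  have ac: "c > 2 * a" using c by (simp add: a_def)
  have \<beta>: "\<beta> > 0" "\<beta> * a < 1" "2 / \<beta> < c"
    using a ac by (auto simp: \<beta>_def field_simps)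
  define K where "K = (\<lambda>n. nat \<lfloor>\<beta> * ln (real n)\<rfloor>)"
  have lim: "\<forall>\<^sub>F n in sequentially. \<beta> * ln (real n) < real n"
    using \<beta>(1) by real_asymp
  have "((\<lambda>n. real n powr (\<beta> * a) / (real n / ln (real n))) \<longlongrightarrow> 0) sequentially"
    using \<beta>(2) by real_asymp
  hence small: "\<forall>\<^sub>F n in sequentially. real n powr (\<beta> * a) / (real n / ln (real n)) < c - 2 / \<beta>"
    using \<beta>(3) by (intro order_tendstoD) auto
  have "\<forall>\<^sub>F n in sequentially. K n < n \<and> real (K n) \<le> \<beta> * ln (real n) \<and>
    real (card (unordered_upto (K n))) + 2 * real n / real (Suc (K n)) - 1 \<le> c * (real n / ln (real n))"
    using eventually_ge_at_top[of 2] lim small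
  proof eventually_elim
    case (elim n)
    have ln: "ln (real n) > 0" using elim by simp
    define R where "R = real n / ln (real n)"
    have R: "R > 0" using ln elim by (simp add: R_def)
    have floor: "real (K n) \<le> \<beta> * ln (real n)" "\<beta> * ln (real n) < real (Suc (K n))"
    proof -
      have "\<beta> * ln (real n) > 0" using \<beta>(1) ln by simp
      thus "real (K n) \<le> \<beta> * ln (real n)" "\<beta> * ln (real n) < real (Suc (K n))"
        unfolding K_def by linarith+
    qed
    have "real (card (unordered_upto (K n))) \<le> (1 / 0.40269750365) ^ K n"
      by (rule card_unordered_upto)
    also have "\<dots> = exp (a * real (K n))"
      by (simp only: exp_of_nat2_mult exp_a)
    also have "\<dots> \<le> exp (a * (\<beta> * ln (real n)))"
      using floor(1) a by simp
    also have "\<dots> = real n powr (\<beta> * a)"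
      using elim by (simp add: powr_def mult_ac)
    also have "\<dots> \<le> (c - 2 / \<beta>) * R"
      using elim(3) R unfolding R_def[symmetric] by (simp add: divide_simps)
    finally have 1: "real (card (unordered_upto (K n))) \<le> (c - 2 / \<beta>) * R" .
    have "2 * real n / real (Suc (K n)) \<le> 2 * real n / (\<beta> * ln (real n))"
      using floor(2) \<beta>(1) ln by (intro divide_left_mono) auto
    also have "\<dots> = 2 / \<beta> * R"
      by (simp add: R_def)
    finally have "real (card (unordered_upto (K n))) + 2 * real n / real (Suc (K n)) \<le> c * R"
      using 1 by (simp add: algebra_simps)
    thus ?case using floor(1) elim(2) unfolding R_def by auto
  qed
  thus ?thesis using \<beta>(1) by blast
qed

text \<open>The cut-off \<open>\<alpha> ln n\<close> is chosen with \<open>\<alpha> \<theta> > 1\<close>, so that the expected number of coincidences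
  among typical subtrees above it, of order \<open>n\<^sup>2 e\<^bsup>-\<theta> \<alpha> ln n\<^esup>\<close>, is a negligible power of \<open>n\<close>.\<close>

lemma lower_bounds:
  fixes c \<theta> :: real
  assumes c: "0 < c" "c < 2 * \<theta>" and rare: "(\<lambda>n. bst_avg n (\<lambda>t. of_bool (atypical \<theta> t))) \<longlonglongrightarrow> 0"
  shows "\<exists>K :: nat \<Rightarrow> nat. \<exists>\<alpha>>0. (\<forall>\<^sub>F n in sequentially. K n < n \<and> real (K n) \<le> \<alpha> * ln (real n) + 1) \<and>
    (\<forall>\<^sub>F n in sequentially. 2 * real n / real (Suc (K n)) - 1 - bst_avg n (atypical_count \<theta> (K n))
        - bst_avg n (repetitions \<theta> (K n) n) \<ge> c * (real n / ln (real n))) \<and>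
    (\<lambda>n. bst_avg n (atypical_count \<theta> (K n)) / (real n / ln (real n))) \<longlonglongrightarrow> 0 \<and>
    (\<lambda>n. bst_avg n (repetitions \<theta> (K n) n) / (real n / ln (real n))) \<longlonglongrightarrow> 0"
proof -
  \<comment> \<open>Makes \<open>2 / \<alpha>\<close> the midpoint of \<open>c\<close> and
    \<open>2 * \<theta>\<close>.\<close>
  define \<alpha> where "\<alpha> = 4 / (c + 2 * \<theta>)"
  have \<theta>: "\<theta> > 0" using c by simp
  have \<alpha>: "\<alpha> > 0" "\<alpha> * \<theta> > 1" "2 / \<alpha> > c"
    using c by (auto simp: \<alpha>_def field_simps)
  define K where "K = (\<lambda>n. nat \<lceil>\<alpha> * ln (real n)\<rceil>)"
  define R where "R = (\<lambda>n. real n / ln (real n))"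
  have R_pos: "R n > 0" if "n \<ge> 2" for n using that by (simp add: R_def)
  have ceil: "\<alpha> * ln (real n) \<le> real (K n)" "real (K n) \<le> \<alpha> * ln (real n) + 1" if "n \<ge> 2" for n
  proof -
    have "\<alpha> * ln (real n) > 0" using that \<alpha>(1) by simp
    thus "\<alpha> * ln (real n) \<le> real (K n)" "real (K n) \<le> \<alpha> * ln (real n) + 1"
      unfolding K_def by linarith+
  qed
  have "\<forall>\<^sub>F n in sequentially. \<alpha> * ln (real n) + 1 < real n"
    using \<alpha>(1) by real_asymp
  hence K_less: "\<forall>\<^sub>F n in sequentially. K n < n \<and> real (K n) \<le> \<alpha> * ln (real n) + 1"
    using eventually_ge_at_top[of 2]
  proof eventually_elim
    case (elim n)
    thus ?case using ceil[of n] by linarith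
  qed
  have K_top: "filterlim K at_top sequentially"
  proof -
    have "filterlim (\<lambda>n. \<alpha> * ln (real n)) at_top sequentially" using \<alpha>(1) by real_asymp
    hence "filterlim (\<lambda>n. real (K n)) at_top sequentially"
      by (rule filterlim_at_top_mono) (use eventually_ge_at_top[of 2] in \<open>eventually_elim, use ceil in auto\<close>)
    thus ?thesis by (simp add: filterlim_sequentially_iff_filterlim_real)
  qed
  have atyp: "(\<lambda>n. bst_avg n (atypical_count \<theta> (K n)) / R n) \<longlonglongrightarrow> 0"
  proof (rule order_tendstoI)
    fix y :: real assume "y < 0"
    show "\<forall>\<^sub>F n in sequentially. y < bst_avg n (atypical_count \<theta> (K n)) / R n"
      using eventually_ge_at_top[of 2]
    proof eventually_elim
      case (elim n)
      have "0 \<le> bst_avg n (atypical_count \<theta> (K n)) / R n"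
        using R_pos[OF elim] by (intro divide_nonneg_pos bst_avg_nonneg atypical_count_nonneg)
      thus ?case using \<open>y < 0\<close> by linarith
    qed
  next
    fix y :: real assume y: "0 < y"
    \<comment> \<open>With this value \<open>2 * n * \<epsilon> / (\<alpha> * ln n)\<close> is
      \<open>y / 2 * R n\<close>; the other half of \<open>y\<close> covers the root.\<close>
    define \<epsilon> where "\<epsilon> = y * \<alpha> / 4"
    have \<epsilon>: "\<epsilon> > 0" using y \<alpha>(1) by (simp add: \<epsilon>_def)
    from order_tendstoD(2)[OF rare \<epsilon>] obtain k0 where
      k0: "\<And>k. k \<ge> k0 \<Longrightarrow> bst_avg k (\<lambda>t. of_bool (atypical \<theta> t)) < \<epsilon>"
      by (auto simp: eventually_sequentially)
    have "((\<lambda>n. 1 / R n) \<longlongrightarrow> 0) sequentially" unfolding R_def by real_asymp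
    hence "\<forall>\<^sub>F n in sequentially. 1 / R n < y / 2"
      using y by (intro order_tendstoD) auto
    moreover have "\<forall>\<^sub>F n in sequentially. K n \<ge> k0"
      using K_top by (simp add: filterlim_at_top)
    ultimately show "\<forall>\<^sub>F n in sequentially. bst_avg n (atypical_count \<theta> (K n)) / R n < y"
      using K_less eventually_ge_at_top[of 2]
    proof eventually_elim
      case (elim n)
      have ln: "ln (real n) > 0" using elim by simp
      have "bst_avg n (atypical_count \<theta> (K n)) \<le> 1 + 2 * real n * \<epsilon> / real (Suc (K n))"
        using elim k0 \<epsilon> by (intro atypical_count_mean) (auto intro!: less_imp_le)
      also have "\<dots> \<le> 1 + 2 * real n * \<epsilon> / (\<alpha> * ln (real n))"
        using ceil[of n] elim \<epsilon> \<alpha>(1) ln by (intro add_left_mono divide_left_mono) auto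
      also have "\<dots> = 1 + y / 2 * R n"
        using \<alpha>(1) by (simp add: R_def \<epsilon>_def)
      finally have "bst_avg n (atypical_count \<theta> (K n)) / R n \<le> (1 + y / 2 * R n) / R n"
        using R_pos[of n] elim by (intro divide_right_mono) auto
      also have "\<dots> = 1 / R n + y / 2"
        using R_pos[of n] elim by (simp add: add_divide_distrib)
      finally show ?case using elim by linarith
    qed
  qed
  have rep: "(\<lambda>n. bst_avg n (repetitions \<theta> (K n) n) / R n) \<longlonglongrightarrow> 0"
  proof (rule tendsto_sandwich)
    show "\<forall>\<^sub>F n in sequentially. 0 \<le> bst_avg n (repetitions \<theta> (K n) n) / R n"
      using eventually_ge_at_top[of 2]
    proof eventually_elim
      case (elim n)
      thus ?case using R_pos[OF elim] by (intro divide_nonneg_pos bst_avg_nonneg repetitions_nonneg)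
    qed
    show "\<forall>\<^sub>F n in sequentially. bst_avg n (repetitions \<theta> (K n) n) / R n
            \<le> real n powr (2 - \<alpha> * \<theta>) / R n * (1 / (1 - exp (- \<theta>)))"
      using eventually_ge_at_top[of 2]
    proof eventually_elim
      case (elim n)
      have "bst_avg n (repetitions \<theta> (K n) n) \<le> (real n)\<^sup>2 * (exp (- (\<theta> * real (K n))) / (1 - exp (- \<theta>)))"
        using \<theta> elim by (intro repetitions_mean) auto
      also have "\<dots> \<le> (real n)\<^sup>2 * (exp (- (\<theta> * (\<alpha> * ln (real n)))) / (1 - exp (- \<theta>)))"
        using ceil(1)[OF elim] \<theta> by (intro mult_left_mono divide_right_mono) auto
      also have "exp (- (\<theta> * (\<alpha> * ln (real n)))) = real n powr (- (\<alpha> * \<theta>))"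
        using elim by (simp add: powr_def mult_ac)
      also have "(real n)\<^sup>2 * (real n powr (- (\<alpha> * \<theta>)) / (1 - exp (- \<theta>))) = real n powr (2 - \<alpha> * \<theta>) * (1 / (1 - exp (- \<theta>)))"
        using elim by (simp add: powr_diff powr_minus_divide)
      finally show ?case
        unfolding times_divide_eq_left[of _ "R n"] using R_pos[OF elim] by (intro divide_right_mono) auto
    qed
    have "(\<lambda>n. real n powr (2 - \<alpha> * \<theta>) / R n) \<longlonglongrightarrow> 0"
      using \<alpha>(2) unfolding R_def by real_asymp
    thus "(\<lambda>n. real n powr (2 - \<alpha> * \<theta>) / R n * (1 / (1 - exp (- \<theta>)))) \<longlonglongrightarrow> 0"
      by (rule tendsto_mult_left_zero)
  qed auto
  \<comment> \<open>The \<open>+ 2\<close> bounds \<open>Suc (K n)\<close>: one for the ceiling and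
    one for the successor.\<close>
  have "(\<lambda>n. (2 * real n / (\<alpha> * ln (real n) + 2) - 1) / R n) \<longlonglongrightarrow> 2 * inverse \<alpha>"
    using \<alpha>(1) unfolding R_def by real_asymp
  hence "(\<lambda>n. (2 * real n / (\<alpha> * ln (real n) + 2) - 1) / R n) \<longlonglongrightarrow> 2 / \<alpha>"
    by (simp only: divide_inverse)
  from tendsto_diff[OF tendsto_diff[OF this atyp] rep]
  have "\<forall>\<^sub>F n in sequentially. c < (2 * real n / (\<alpha> * ln (real n) + 2) - 1) / R n
      - bst_avg n (atypical_count \<theta> (K n)) / R n - bst_avg n (repetitions \<theta> (K n) n) / R n"
    using \<alpha>(3) by (intro order_tendstoD) auto
  hence "\<forall>\<^sub>F n in sequentially. 2 * real n / real (Suc (K n)) - 1 - bst_avg n (atypical_count \<theta> (K n))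
        - bst_avg n (repetitions \<theta> (K n) n) \<ge> c * R n"
    using eventually_ge_at_top[of 2]
  proof eventually_elim
    case (elim n)
    have "c * R n \<le> 2 * real n / (\<alpha> * ln (real n) + 2) - 1 - bst_avg n (atypical_count \<theta> (K n))
        - bst_avg n (repetitions \<theta> (K n) n)"
      using elim(1) R_pos[OF elim(2)] by (simp add: diff_divide_distrib[symmetric] less_divide_eq)
    moreover have "2 * real n / (\<alpha> * ln (real n) + 2) \<le> 2 * real n / real (Suc (K n))"
      using ceil[OF elim(2)] by (intro divide_left_mono) auto
    ultimately show ?case by linarith
  qed
  thus ?thesis
    using \<alpha>(1) K_less atyp rep unfolding R_def by blast
qed

text \<open>Chebyshev's inequality for \<open>large_count\<close>: a variance of order
  \<open>n * (ln n)\<^sup>2\<close> against the square of \<open>\<eta> * n / ln n\<close>.\<close>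

lemma upper_tail:
  fixes c \<eta> :: real
  assumes "c > - 2 * ln 0.40269750365" "\<eta> > 0"
  shows "(\<lambda>n. bst_avg n (\<lambda>t. of_bool (real (num_noniso_fringe t) > (c + \<eta>) * (real n / ln (real n))))) \<longlonglongrightarrow> 0"
proof -
  obtain K \<beta> where \<beta>: "\<beta> > 0" and K: "\<forall>\<^sub>F n in sequentially. K n < n \<and> real (K n) \<le> \<beta> * ln (real n) \<and>
    real (card (unordered_upto (K n))) + 2 * real n / real (Suc (K n)) - 1 \<le> c * (real n / ln (real n))"
    using upper_bounds[OF assms(1)] by blast
  show ?thesis
  proof (rule tendsto_sandwich)
    show "\<forall>\<^sub>F n in sequentially. 0 \<le> bst_avg n (\<lambda>t. of_bool (real (num_noniso_fringe t) > (c + \<eta>) * (real n / ln (real n))))"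
      by (intro always_eventually allI bst_avg_nonneg) auto
    show "\<forall>\<^sub>F n in sequentially. bst_avg n (\<lambda>t. of_bool (real (num_noniso_fringe t) > (c + \<eta>) * (real n / ln (real n))))
        \<le> 16 * (\<beta> * ln (real n))\<^sup>2 * real n / (\<eta> * (real n / ln (real n)))\<^sup>2"
      using K eventually_ge_at_top[of 2]
    proof eventually_elim
      case (elim n)
      define R where "R = real n / ln (real n)"
      have R: "\<eta> * R > 0" using elim assms(2) by (simp add: R_def)
      define m where "m = 2 * real n / real (Suc (K n)) - 1"
      have "of_bool (real (num_noniso_fringe t) > (c + \<eta>) * R) \<le> (large_count (K n) t - m)\<^sup>2 / (\<eta> * R)\<^sup>2" for t
      proof (cases "real (num_noniso_fringe t) > (c + \<eta>) * R")
        case True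
        have "real (card (unordered_upto (K n))) + m \<le> c * R"
          using elim by (simp add: R_def m_def)
        hence "\<eta> * R \<le> large_count (K n) t - m"
          using num_noniso_fringe_le[of t "K n"] True by (simp add: algebra_simps)
        hence "(\<eta> * R)\<^sup>2 \<le> (large_count (K n) t - m)\<^sup>2"
          using R by (intro power_mono) auto
        moreover have "(\<eta> * R)\<^sup>2 > 0" using R by (rule zero_less_power)
        ultimately have "1 \<le> (large_count (K n) t - m)\<^sup>2 / (\<eta> * R)\<^sup>2"
          by (subst le_divide_eq_1_pos)
        thus ?thesis using True by simp
      qed auto
      hence "bst_avg n (\<lambda>t. of_bool (real (num_noniso_fringe t) > (c + \<eta>) * R))
          \<le> bst_avg n (\<lambda>t. (large_count (K n) t - m)\<^sup>2 / (\<eta> * R)\<^sup>2)"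
        by (intro bst_avg_mono)
      also have "\<dots> \<le> (16 * (real (K n))\<^sup>2 * real n) / (\<eta> * R)\<^sup>2"
        unfolding bst_avg_divide m_def using elim
        by (intro divide_right_mono large_count_variance) auto
      also have "\<dots> \<le> (16 * (\<beta> * ln (real n))\<^sup>2 * real n) / (\<eta> * R)\<^sup>2"
        using elim by (intro divide_right_mono mult_right_mono mult_left_mono power_mono) auto
      finally show ?case by (simp add: R_def)
    qed
    show "(\<lambda>n. 16 * (\<beta> * ln (real n))\<^sup>2 * real n / (\<eta> * (real n / ln (real n)))\<^sup>2) \<longlonglongrightarrow> 0"
      using \<beta> assms(2) by real_asymp
  qed auto
qed

lemma lower_tail:
  fixes c \<theta> \<eta> :: real
  assumes c: "0 < c" "c < 2 * \<theta>" and rare: "(\<lambda>n. bst_avg n (\<lambda>t. of_bool (atypical \<theta> t))) \<longlonglongrightarrow> 0"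
    and "\<eta> > 0"
  shows "(\<lambda>n. bst_avg n (\<lambda>t. of_bool (real (num_noniso_fringe t) < (c - \<eta>) * (real n / ln (real n))))) \<longlonglongrightarrow> 0"
proof -
  define R where "R = (\<lambda>n. real n / ln (real n))"
  obtain K \<alpha> where \<alpha>: "\<alpha> > 0"
    and K: "\<forall>\<^sub>F n in sequentially. K n < n \<and> real (K n) \<le> \<alpha> * ln (real n) + 1"
    and mean: "\<forall>\<^sub>F n in sequentially. 2 * real n / real (Suc (K n)) - 1 - bst_avg n (atypical_count \<theta> (K n))
        - bst_avg n (repetitions \<theta> (K n) n) \<ge> c * R n"
    and atyp: "(\<lambda>n. bst_avg n (atypical_count \<theta> (K n)) / R n) \<longlonglongrightarrow> 0"
    and rep: "(\<lambda>n. bst_avg n (repetitions \<theta> (K n) n) / R n) \<longlonglongrightarrow> 0"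
    using lower_bounds[OF c rare] unfolding R_def by blast
  \<comment> \<open>A deficit of \<open>\<eta> * R n\<close> forces one of three sources to
    contribute a third of it: too few large subtrees (Chebyshev), too many atypical ones, or too
    many repetitions (Markov for both).\<close>
  define B where "B = (\<lambda>n. 16 * (\<alpha> * ln (real n) + 1)\<^sup>2 * real n / (\<eta> / 3 * R n)\<^sup>2
      + 3 / \<eta> * (bst_avg n (atypical_count \<theta> (K n)) / R n) + 3 / \<eta> * (bst_avg n (repetitions \<theta> (K n) n) / R n))"
  have "(\<lambda>n. bst_avg n (\<lambda>t. of_bool (real (num_noniso_fringe t) < (c - \<eta>) * R n))) \<longlonglongrightarrow> 0"
  proof (rule tendsto_sandwich)
    show "\<forall>\<^sub>F n in sequentially. 0 \<le> bst_avg n (\<lambda>t. of_bool (real (num_noniso_fringe t) < (c - \<eta>) * R n))"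
      by (intro always_eventually allI bst_avg_nonneg) auto
    show "\<forall>\<^sub>F n in sequentially. bst_avg n (\<lambda>t. of_bool (real (num_noniso_fringe t) < (c - \<eta>) * R n)) \<le> B n"
      using K mean eventually_ge_at_top[of 2]
    proof eventually_elim
      case (elim n)
      have R: "R n > 0" using elim by (simp add: R_def)
      define m where "m = 2 * real n / real (Suc (K n)) - 1"
      define L where "L = large_count (K n)"
      define A where "A = atypical_count \<theta> (K n)"
      define Q where "Q = repetitions \<theta> (K n) n"
      have AQ: "A t \<ge> 0" "Q t \<ge> 0" for t
        unfolding A_def Q_def by (rule atypical_count_nonneg repetitions_nonneg)+
      have avg: "0 \<le> bst_avg n A" "0 \<le> bst_avg n Q"
        using AQ by (auto intro!: bst_avg_nonneg)
      have "of_bool (real (num_noniso_fringe t) < (c - \<eta>) * R n)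
          \<le> (L t - m)\<^sup>2 / (\<eta> / 3 * R n)\<^sup>2 + 3 / \<eta> * (A t / R n) + 3 / \<eta> * (Q t / R n)"
        if t: "size1 t = n" for t
      proof (cases "real (num_noniso_fringe t) < (c - \<eta>) * R n")
        case True
        have "m \<ge> c * R n" using elim(2) avg unfolding m_def A_def Q_def by linarith
        moreover have "L t - A t - Q t < (c - \<eta>) * R n"
          using num_noniso_fringe_ge[of t n "K n" \<theta>] True t unfolding L_def A_def Q_def by linarith
        moreover have "(c - \<eta>) * R n = c * R n - 3 * (\<eta> / 3 * R n)" by (simp add: algebra_simps)
        ultimately consider "m - L t \<ge> \<eta> / 3 * R n" | "A t \<ge> \<eta> / 3 * R n" | "Q t \<ge> \<eta> / 3 * R n"
          by linarith
        hence "1 \<le> (L t - m)\<^sup>2 / (\<eta> / 3 * R n)\<^sup>2 \<or> 1 \<le> 3 / \<eta> * (A t / R n) \<or> 1 \<le> 3 / \<eta> * (Q t / R n)"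
        proof cases
          case 1
          hence "(\<eta> / 3 * R n)\<^sup>2 \<le> (m - L t)\<^sup>2"
            using R assms by (intro power_mono) auto
          thus ?thesis using R assms by (simp add: power2_commute[of m] divide_simps)
        qed (use R assms in \<open>simp_all add: field_simps\<close>)
        moreover have "0 \<le> (L t - m)\<^sup>2 / (\<eta> / 3 * R n)\<^sup>2" "0 \<le> 3 / \<eta> * (A t / R n)" "0 \<le> 3 / \<eta> * (Q t / R n)"
          using R assms AQ[of t] by auto
        ultimately have "1 \<le> (L t - m)\<^sup>2 / (\<eta> / 3 * R n)\<^sup>2 + 3 / \<eta> * (A t / R n) + 3 / \<eta> * (Q t / R n)"
          by - (elim disjE; linarith)
        thus ?thesis using True by simp
      qed (use R assms AQ[of t] in auto)
      hence "bst_avg n (\<lambda>t. of_bool (real (num_noniso_fringe t) < (c - \<eta>) * R n)) \<le>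
        bst_avg n (\<lambda>t. (L t - m)\<^sup>2 / (\<eta> / 3 * R n)\<^sup>2 + 3 / \<eta> * (A t / R n) + 3 / \<eta> * (Q t / R n))"
        by (rule bst_avg_mono)
      also have "\<dots> = bst_avg n (\<lambda>t. (L t - m)\<^sup>2) / (\<eta> / 3 * R n)\<^sup>2 + 3 / \<eta> * (bst_avg n A / R n) + 3 / \<eta> * (bst_avg n Q / R n)"
        by (simp only: bst_avg_add bst_avg_cmult bst_avg_divide)
      also have "bst_avg n (\<lambda>t. (L t - m)\<^sup>2) \<le> 16 * (real (K n))\<^sup>2 * real n"
        unfolding L_def m_def using elim by (intro large_count_variance) auto
      also have "\<dots> \<le> 16 * (\<alpha> * ln (real n) + 1)\<^sup>2 * real n"
        using elim by (intro mult_right_mono mult_left_mono power_mono) auto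
      finally show ?case
        by (simp add: B_def A_def Q_def divide_right_mono)
    qed
    have "(\<lambda>n. 16 * (\<alpha> * ln (real n) + 1)\<^sup>2 * real n / (\<eta> / 3 * R n)\<^sup>2) \<longlonglongrightarrow> 0"
      unfolding R_def using \<alpha> assms by real_asymp
    from tendsto_add[OF tendsto_add[OF this tendsto_mult_right_zero[OF atyp, of "3 / \<eta>"]]
        tendsto_mult_right_zero[OF rep, of "3 / \<eta>"]]
    show "B \<longlonglongrightarrow> 0" unfolding B_def by (simp only: add_0_right)
  qed auto
  thus ?thesis by (simp only: R_def)
qed

theorem theorem2:
  "\<exists>c3 c4 :: real.
     \<bar>c3 - 1.5470025923\<bar> < 1 / 10 ^ 10 \<and> \<bar>c4 - 1.8191392203\<bar> < 1 / 10 ^ 10 \<and>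
     (\<exists>e1 e2 :: nat \<Rightarrow> real. e1 \<in> o(\<lambda>_. 1) \<and> e2 \<in> o(\<lambda>_. 1) \<and>
        (\<forall>\<^sub>F n in sequentially.
           c3 * (real n / ln (real n)) * (1 + e1 n)
             \<le> measure_pmf.expectation (bst_pmf n) (\<lambda>t. real (num_noniso_fringe t)) \<and>
           measure_pmf.expectation (bst_pmf n) (\<lambda>t. real (num_noniso_fringe t))
             \<le> c4 * (real n / ln (real n)) * (1 + e2 n))) \<and>
     (\<forall>\<eta>>0.
        (\<lambda>n. measure_pmf.prob (bst_pmf n)
               {t. (c3 - \<eta>) * (real n / ln (real n)) \<le> real (num_noniso_fringe t) \<and>
                   real (num_noniso_fringe t) \<le> (c4 + \<eta>) * (real n / ln (real n))})
          \<longlonglongrightarrow> 1)"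
proof -
  \<comment> \<open>Twice the threshold of \<open>entropy_rate_exceeds\<close> and the bound of
    \<open>ln_utree_radius\<close>. Both estimates are strict, which is why the error terms
    \<open>e1\<close> and \<open>e2\<close> can be taken as 0 at the end.\<close>
  define c3 c4 :: real where "c3 = 1.547002592205" and "c4 = 1.81913922039"
  define R where "R = (\<lambda>n. real n / ln (real n))"
  obtain K0 where K0: "fringe_density K0 (entropy_toll K0) - ln 2 > 0.7735012961025"
    using entropy_rate_exceeds by blast
  obtain \<theta> where \<theta>: "0.7735012961025 < \<theta>" "\<theta> < fringe_density K0 (entropy_toll K0) - ln 2"
    using dense[OF K0] by blast
  have rare: "(\<lambda>n. bst_avg n (\<lambda>t. of_bool (atypical \<theta> t))) \<longlonglongrightarrow> 0"
    by (rule atypical_rare[OF \<theta>(2)])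
  have c3: "0 < c3" "c3 < 2 * \<theta>" using \<theta> by (simp_all add: c3_def)
  have c4: "c4 > - 2 * ln 0.40269750365" using ln_utree_radius by (simp add: c4_def)
  have upper: "\<forall>\<^sub>F n in sequentially. bst_avg n (\<lambda>t. real (num_noniso_fringe t)) \<le> c4 * R n"
  proof -
    obtain K \<beta> where K: "\<forall>\<^sub>F n in sequentially. K n < n \<and> real (K n) \<le> \<beta> * ln (real n) \<and>
      real (card (unordered_upto (K n))) + 2 * real n / real (Suc (K n)) - 1 \<le> c4 * R n"
      using upper_bounds[OF c4] unfolding R_def by blast
    show ?thesis
      using K
    proof eventually_elim
      case (elim n)
      have "bst_avg n (\<lambda>t. real (num_noniso_fringe t)) \<le> bst_avg n (\<lambda>t. real (card (unordered_upto (K n))) + large_count (K n) t)"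
        by (intro bst_avg_mono num_noniso_fringe_le)
      also have "\<dots> = real (card (unordered_upto (K n))) + (2 * real n / real (Suc (K n)) - 1)"
        using elim by (simp add: bst_avg_add bst_avg_const large_count_mean del: of_nat_Suc)
      finally show ?case using elim by linarith
    qed
  qed
  have lower: "\<forall>\<^sub>F n in sequentially. c3 * R n \<le> bst_avg n (\<lambda>t. real (num_noniso_fringe t))"
  proof -
    obtain K \<alpha> where K: "\<forall>\<^sub>F n in sequentially. K n < n \<and> real (K n) \<le> \<alpha> * ln (real n) + 1"
      and mean: "\<forall>\<^sub>F n in sequentially. 2 * real n / real (Suc (K n)) - 1 - bst_avg n (atypical_count \<theta> (K n))
        - bst_avg n (repetitions \<theta> (K n) n) \<ge> c3 * R n"
      using lower_bounds[OF c3 rare] unfolding R_def by blast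
    show ?thesis
      using K mean
    proof eventually_elim
      case (elim n)
      have "2 * real n / real (Suc (K n)) - 1 - bst_avg n (atypical_count \<theta> (K n)) - bst_avg n (repetitions \<theta> (K n) n)
          = bst_avg n (\<lambda>t. large_count (K n) t - atypical_count \<theta> (K n) t - repetitions \<theta> (K n) n t)"
        using elim by (simp add: bst_avg_diff large_count_mean del: of_nat_Suc)
      also have "\<dots> \<le> bst_avg n (\<lambda>t. real (num_noniso_fringe t))"
        by (intro bst_avg_mono num_noniso_fringe_ge) auto
      finally show ?case using elim by linarith
    qed
  qed
  have whp: "(\<lambda>n. measure_pmf.prob (bst_pmf n)
               {t. (c3 - \<eta>) * R n \<le> real (num_noniso_fringe t) \<and>
                   real (num_noniso_fringe t) \<le> (c4 + \<eta>) * R n}) \<longlonglongrightarrow> 1" if "\<eta> > 0" for \<eta>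
  proof (rule tendsto_sandwich)
    define f where "f = (\<lambda>n. bst_avg n (\<lambda>t. of_bool (real (num_noniso_fringe t) < (c3 - \<eta>) * R n)))"
    define g where "g = (\<lambda>n. bst_avg n (\<lambda>t. of_bool (real (num_noniso_fringe t) > (c4 + \<eta>) * R n)))"
    have "f \<longlonglongrightarrow> 0" "g \<longlonglongrightarrow> 0"
      unfolding f_def g_def R_def using lower_tail[OF c3 rare that] upper_tail[OF c4 that] by blast+
    from tendsto_diff[OF tendsto_diff[OF tendsto_const this(1)] this(2), of 1]
    show "(\<lambda>n. 1 - f n - g n) \<longlonglongrightarrow> 1" by simp
    show "\<forall>\<^sub>F n in sequentially. 1 - f n - g n \<le> measure_pmf.prob (bst_pmf n)
               {t. (c3 - \<eta>) * R n \<le> real (num_noniso_fringe t) \<and> real (num_noniso_fringe t) \<le> (c4 + \<eta>) * R n}"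
      using eventually_ge_at_top[of 1]
    proof eventually_elim
      case (elim n)
      have "1 - f n - g n = bst_avg n (\<lambda>t. 1 - of_bool (real (num_noniso_fringe t) < (c3 - \<eta>) * R n)
          - of_bool (real (num_noniso_fringe t) > (c4 + \<eta>) * R n))"
        using elim by (simp add: f_def g_def bst_avg_diff bst_avg_const)
      also have "\<dots> \<le> bst_avg n (\<lambda>t. of_bool ((c3 - \<eta>) * R n \<le> real (num_noniso_fringe t) \<and>
          real (num_noniso_fringe t) \<le> (c4 + \<eta>) * R n))"
        by (intro bst_avg_mono) (auto simp: not_less not_le)
      finally show ?case
        by (simp add: prob_bst_pmf[OF elim])
    qed
  qed auto
  have close: "\<bar>c3 - 1.5470025923\<bar> < 1 / 10 ^ 10" "\<bar>c4 - 1.8191392203\<bar> < 1 / 10 ^ 10"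
    by (simp_all add: c3_def c4_def)
  have avg: "\<forall>\<^sub>F n in sequentially.
      c3 * (real n / ln (real n)) * (1 + 0) \<le> measure_pmf.expectation (bst_pmf n) (\<lambda>t. real (num_noniso_fringe t)) \<and>
      measure_pmf.expectation (bst_pmf n) (\<lambda>t. real (num_noniso_fringe t)) \<le> c4 * (real n / ln (real n)) * (1 + 0)"
    using upper lower eventually_ge_at_top[of 1]
    by eventually_elim (simp add: expectation_bst_pmf R_def)
  have little_o: "(\<lambda>_ :: nat. 0 :: real) \<in> o(\<lambda>_. 1)" by simp
  show ?thesis
    by (rule exI[of _ c3], rule exI[of _ c4], rule conjI, rule close, rule conjI, rule close, rule conjI,
        rule exI[of _ "\<lambda>_. 0"], rule exI[of _ "\<lambda>_. 0"], intro conjI little_o avg, intro allI impI,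
        rule whp[unfolded R_def])
qed

end
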